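(* Let $n\in\mathbb{N}$, let $X_1,\ldots,X_n$ be real-valued random variables with distributions $F_1,\ldots,F_n\in\mathcal{D}\cap\mathcal{L}$ respectively, and let $\Theta_1,\ldots,\Theta_n$ be non-negative random variables, non-degenerate at zero. Suppose that: (i) there exist functions $b_i:[0,\infty)\to(0,\infty)$, $i=1,\ldots,n$, such that $b_i(x)\to\infty$ and $b_i(x)/x\to 0$ as $x\to\infty$, and, for all $1\le i\ne j\le n$, $$\mathbf{P}[\Theta_i>b_i(x_i)]=o\big(\mathbf{P}[\Theta_iX_i>x_i,\ \Theta_jX_j>x_j]\big)\quad\text{as } x_i\wedge x_j\to\infty;$$ (ii) for each $i=1,\ldots,n$ there exists a function $h_i:[0,\infty)\to(0,\infty)$ such that $$\mathbf{P}[X_i>x\mid\Theta_i=\theta]\sim h_i(\theta)\,\mathbf{P}[X_i>x]\quad\text{as }x\to\infty,\ \text{uniformly for }\theta\in s_{\Theta_i};$$ (iii) there exist measurable functions $g_{ij}:[0,\infty)^2\to(0,\infty)$, $1\le i\ne j\le n$, and constants $0<L\le U<\infty$ such that, for all $1\le i\neq j\le n$, as $x_i\wedge x_j\to\infty$, uniformly for $(\theta_i,\theta_j)\in s_{\Theta_i}\times s_{\Theta_j}$, $$\mathbf{P}[|X_i|>x_i,\ X_j>x_j\mid\Theta_i=\theta_i,\Theta_j=\theta_j]\sim g_{ij}(\theta_i,\theta_j)\,\mathbf{P}[|X_i|>x_i,\ X_j>x_j]$$ and $$L\,g_{ij}(\theta_i,\theta_j)\mathbf{P}[X_i>x_i,X_j>x_j]\lesssim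 \mathbf{P}[X_i>x_i,X_j>x_j\mid\Theta_i=\theta_i,\Theta_j=\theta_j]\lesssim U\,g_{ij}(\theta_i,\theta_j)\mathbf{P}[X_i>x_i,X_j>x_j].$$ Write $S_k^{\Theta}=\sum_{i=1}^k\Theta_iX_i$. Then: (1) If $X_1,\ldots,X_n$ are pTAI, then, as $x\to\infty$, $$\mathbf{P}[S_n^{\Theta}>x]\sim\mathbf{P}\Big[\max_{1\le k\le n}S_k^{\Theta}>x\Big]\sim\mathbf{P}\Big[\max_{1\le i\le n}\Theta_iX_i>x\Big]\sim\sum_{i=1}^n\mathbf{P}[\Theta_iX_i>x].$$ (2) If $X_1,\ldots,X_n$ are pQAI and $F_1,\ldots,F_n\in\mathcal{C}$, then, as $x\to\infty$, $$\mathbf{P}[S_n^{\Theta}>x]\sim\mathbf{P}\Big[\max_{1\le k\le n}S_k^{\Theta}>x\Big]\sim\sum_{i=1}^n\mathbf{P}[\Theta_iX_i>x].$$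
   Context: For a distribution $F$, $\overline F(x)=1-F(x)$; throughout $\overline F_i(x)>0$ for all $x\ge0$ and all $i$. "Non-degenerate at zero" means not almost surely equal to $0$. $x\wedge y=\min\{x,y\}$, $x\vee y=\max\{x,y\}$, $x^+=\max\{x,0\}$, $x^-=-\min\{x,0\}$. $f=o(g)$ means $f/g\to0$; $f\sim g$ means $f/g\to1$; $f\lesssim g$ means $\limsup f/g\le1$; $f\gtrsim g$ means $\liminf f/g\ge1$. Uniformity of $\sim$ over $\theta$ means that the supremum over $\theta$ of $|f/g-1|$ tends to $0$; uniformity of $\lesssim$ means $\limsup$ of the supremum over $\theta$ of the ratio $f/g$ is $\le1$. Support: $s_{\Theta_i}=\{\theta\in\mathbb{R}:\mathbf{P}(\Theta_i\in[\theta-\delta,\theta+\delta])>0\text{ for any }\delta>0\}$. For an event $A$, $\mathbf{P}[A\mid\Theta_i=\theta_i,\Theta_j=\theta_j]$ is defined as $$\lim_{\delta\downarrow0}\frac{\mathbf{P}[A,\ \Theta_i\in[\theta_i-\delta,\theta_i+\delta],\ \Theta_j\in[\theta_j-\delta,\theta_j+\delta]]}{\mathbf{P}[\Theta_i\in[\theta_i-\delta,\theta_i+\delta],\ \Theta_j\in[\theta_j-\delta,\theta_j+\delta]]},$$ and $\mathbf{P}[A\mid\Theta_i=\theta]$ is defined analogously with a single weight. Distribution classes: $F\in\mathcal{D}$ if $\limsup_{x\to\infty}\overline F(bx)/\overline F(x)<\infty$ for any (equivalently, some) $b\in(0,1)$; $F\in\mathcal{L}$ if $\lim_{x\to\infty}\overline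 F(x-a)/\overline F(x)=1$ for any (equivalently, some) $a>0$; $F\in\mathcal{C}$ if $\lim_{v\uparrow1}\limsup_{x\to\infty}\overline F(vx)/\overline F(x)=1$. Real-valued random variables $Y_1,\ldots,Y_n$ are pTAI (pairwise tail asymptotically independent) if for all $i\ne j$, $\lim_{x_i\wedge x_j\to\infty}\mathbf{P}[|Y_i|>x_i\mid Y_j>x_j]=0$. They are pQAI (pairwise quasi-asymptotically independent) if for all $i\neq j$, $$\lim_{x\to\infty}\frac{\mathbf{P}[Y_i^+>x,\,Y_j^+>x]}{\mathbf{P}[Y_i>x]+\mathbf{P}[Y_j>x]}=\lim_{x\to\infty}\frac{\mathbf{P}[Y_i^->x,\,Y_j>x]}{\mathbf{P}[Y_i>x]+\mathbf{P}[Y_j>x]}=0.$$ *)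

theory Defs
  imports "HOL-Probability.Probability" "HOL-Library.Landau_Symbols"
begin

definition tail :: "real measure \<Rightarrow> real \<Rightarrow> real" where
  "tail F x = 1 - cdf F x"

definition dominatedly_varying :: "real measure \<Rightarrow> bool" where
  "dominatedly_varying F \<longleftrightarrow>
     (\<forall>b. 0 < b \<and> b < 1 \<longrightarrow>
        Limsup at_top (\<lambda>x. ereal (tail F (b * x) / tail F x)) < \<infinity>)"

definition long_tailed :: "real measure \<Rightarrow> bool" where
  "long_tailed F \<longleftrightarrow>
     (\<forall>a>0. ((\<lambda>x. tail F (x - a) / tail F x) \<longlongrightarrow> 1) at_top)"

definition consistently_varying :: "real measure \<Rightarrow> bool" where
  "consistently_varying F \<longleftrightarrow>
     ((\<lambda>v. Limsup at_top (\<lambda>x. ereal (tail F (v * x) / tail F x))) \<longlongrightarrow> 1) (at_left 1)"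

definition pTAI :: "'a measure \<Rightarrow> nat \<Rightarrow> (nat \<Rightarrow> 'a \<Rightarrow> real) \<Rightarrow> bool" where
  "pTAI M n Y \<longleftrightarrow>
     (\<forall>i\<in>{1..n}. \<forall>j\<in>{1..n}. i \<noteq> j \<longrightarrow>
        ((\<lambda>(xi, xj). \<P>(\<omega> in M. \<bar>Y i \<omega>\<bar> > xi \<bar> Y j \<omega> > xj)) \<longlongrightarrow> 0)
          (at_top \<times>\<^sub>F at_top))"

definition pQAI :: "'a measure \<Rightarrow> nat \<Rightarrow> (nat \<Rightarrow> 'a \<Rightarrow> real) \<Rightarrow> bool" where
  "pQAI M n Y \<longleftrightarrow>
     (\<forall>i\<in>{1..n}. \<forall>j\<in>{1..n}. i \<noteq> j \<longrightarrow>
        ((\<lambda>x. \<P>(\<omega> in M. max (Y i \<omega>) 0 > x \<and> max (Y j \<omega>) 0 > x) /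
              (\<P>(\<omega> in M. Y i \<omega> > x) + \<P>(\<omega> in M. Y j \<omega> > x))) \<longlongrightarrow> 0) at_top \<and>
        ((\<lambda>x. \<P>(\<omega> in M. - min (Y i \<omega>) 0 > x \<and> Y j \<omega> > x) /
              (\<P>(\<omega> in M. Y i \<omega> > x) + \<P>(\<omega> in M. Y j \<omega> > x))) \<longlongrightarrow> 0) at_top)"

definition supp :: "'a measure \<Rightarrow> ('a \<Rightarrow> real) \<Rightarrow> real set" where
  "supp M T = {\<theta>. \<forall>\<delta>>0. \<P>(\<omega> in M. T \<omega> \<in> {\<theta> - \<delta>..\<theta> + \<delta>}) > 0}"

text \<open>Conditioning on the values of one or two random variables is a limit over shrinking closed
  windows. The value \<open>cprob\<close> is only meaningful together with \<open>cprob_exists\<close>: every window has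
  positive probability (so no quotient involves division by zero) and the limit exists.\<close>

definition cprob :: "'a measure \<Rightarrow> ('a \<Rightarrow> bool) \<Rightarrow> ('a \<Rightarrow> real) \<Rightarrow> real \<Rightarrow> real" where
  "cprob M A T \<theta> =
     Lim (at_right 0) (\<lambda>\<delta>. \<P>(\<omega> in M. A \<omega> \<bar> T \<omega> \<in> {\<theta> - \<delta>..\<theta> + \<delta>}))"

definition cprob_exists :: "'a measure \<Rightarrow> ('a \<Rightarrow> bool) \<Rightarrow> ('a \<Rightarrow> real) \<Rightarrow> real \<Rightarrow> bool" where
  "cprob_exists M A T \<theta> \<longleftrightarrow>
     (\<forall>\<delta>>0. \<P>(\<omega> in M. T \<omega> \<in> {\<theta> - \<delta>..\<theta> + \<delta>}) > 0) \<and>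
     (\<exists>l. ((\<lambda>\<delta>. \<P>(\<omega> in M. A \<omega> \<bar> T \<omega> \<in> {\<theta> - \<delta>..\<theta> + \<delta>})) \<longlongrightarrow> l) (at_right 0))"

definition cprob2 ::
  "'a measure \<Rightarrow> ('a \<Rightarrow> bool) \<Rightarrow> ('a \<Rightarrow> real) \<Rightarrow> ('a \<Rightarrow> real) \<Rightarrow> real \<times> real \<Rightarrow> real" where
  "cprob2 M A T T' = (\<lambda>(\<theta>, \<theta>').
     Lim (at_right 0) (\<lambda>\<delta>. \<P>(\<omega> in M. A \<omega> \<bar>
       T \<omega> \<in> {\<theta> - \<delta>..\<theta> + \<delta>} \<and> T' \<omega> \<in> {\<theta>' - \<delta>..\<theta>' + \<delta>})))"

definition cprob2_exists ::
  "'a measure \<Rightarrow> ('a \<Rightarrow> bool) \<Rightarrow> ('a \<Rightarrow> real) \<Rightarrow> ('a \<Rightarrow> real) \<Rightarrow> real \<times> real \<Rightarrow> bool" where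
  "cprob2_exists M A T T' = (\<lambda>(\<theta>, \<theta>').
     (\<forall>\<delta>>0. \<P>(\<omega> in M.
        T \<omega> \<in> {\<theta> - \<delta>..\<theta> + \<delta>} \<and> T' \<omega> \<in> {\<theta>' - \<delta>..\<theta>' + \<delta>}) > 0) \<and>
     (\<exists>l. ((\<lambda>\<delta>. \<P>(\<omega> in M. A \<omega> \<bar>
        T \<omega> \<in> {\<theta> - \<delta>..\<theta> + \<delta>} \<and> T' \<omega> \<in> {\<theta>' - \<delta>..\<theta>' + \<delta>})) \<longlongrightarrow> l) (at_right 0)))"

text \<open>The quotient \<open>0 / 0\<close> counts as \<open>1\<close>, the convention of \<^const>\<open>asymp_equiv\<close>.\<close>

definition unif_asymp_equiv ::
  "'t set \<Rightarrow> 'x filter \<Rightarrow> ('x \<Rightarrow> 't \<Rightarrow> real) \<Rightarrow> ('x \<Rightarrow> 't \<Rightarrow> real) \<Rightarrow> bool" where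
  "unif_asymp_equiv S G f g \<longleftrightarrow>
     uniform_limit S
       (\<lambda>x \<theta>. if f x \<theta> = 0 \<and> g x \<theta> = 0 then 1 else f x \<theta> / g x \<theta>) (\<lambda>_. 1) G"

text \<open>The division is that of \<^typ>\<open>ereal\<close>, where \<open>a / 0 = \<infinity>\<close> for \<open>a > 0\<close> and \<open>0 / 0 = 0\<close>: a
  vanishing right-hand side forces a vanishing left-hand side.\<close>

definition unif_asymp_le ::
  "'t set \<Rightarrow> 'x filter \<Rightarrow> ('x \<Rightarrow> 't \<Rightarrow> real) \<Rightarrow> ('x \<Rightarrow> 't \<Rightarrow> real) \<Rightarrow> bool" where
  "unif_asymp_le S G f g \<longleftrightarrow>
     Limsup G (\<lambda>x. SUP \<theta>\<in>S. ereal (f x \<theta>) / ereal (g x \<theta>)) \<le> 1"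

definition wsum :: "(nat \<Rightarrow> 'a \<Rightarrow> real) \<Rightarrow> (nat \<Rightarrow> 'a \<Rightarrow> real) \<Rightarrow> nat \<Rightarrow> 'a \<Rightarrow> real" where
  "wsum \<Theta> X k \<omega> = (\<Sum>i=1..k. \<Theta> i \<omega> * X i \<omega>)"

end

theory Submission imports Defs begin

text \<open>
  For a single variable all the quantities coincide. For at least two, the argument rests on the
  principle of a single big jump, in four steps.

  The weights are essentially bounded. In \<open>b_small\<close> the two levels tend to infinity independently of
  each other; fixing the first and letting the second grow, the right-hand side tends to 0 while the
  left-hand side stays fixed, so that \<open>\<Theta> i \<le> b i x\<close> almost surely for some \<open>x\<close>
  (\<open>AE_bounded_if_small\<close>).

  The conditional tails, given as limits over shrinking windows, are turned into statements about
  sets of weights. A differentiation theorem (\<open>measure_le_if_windows_le\<close>) shows that, up to a factor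
  \<open>1 + \<eta>\<close>, the conditional distribution of the weight given \<open>X i > y\<close> is the same for all large \<open>y\<close>
  (\<open>cprob_tail_comparison\<close>).

  The tail of \<open>\<Theta> i * X i\<close> then inherits the properties of the tail of \<open>X i\<close>. It is bounded below by
  a multiple of the latter (\<open>weighted_tail_lower\<close>). Small weights contribute little to it, since
  they carry a small share of the event that \<open>X i\<close> is large; the remaining weights are cut into
  short intervals, on which the product is nearly a constant multiple of \<open>X i\<close>. Hence the product is
  long-tailed, and consistently varying if \<open>X i\<close> is (\<open>weighted_long_tailed\<close>,
  \<open>weighted_consistently_varying\<close>). As the weights are bounded and the tails dominatedly varying,
  asymptotic independence of the \<open>X i\<close> carries over to the products (\<open>pTAI_weighted_joint_tail\<close>,
  \<open>pQAI_weighted_joint_tail\<close>).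

  Finally, the sum, the maximum of the partial sums and the maximum of the products all exceed \<open>x\<close>
  essentially because exactly one product does (\<open>one_big_jump\<close>). The slack between the levels is a
  large constant in the first part of the theorem, where long tails absorb it, and a small multiple
  of \<open>x\<close> in the second, where consistent variation does.
\<close>

section \<open>Comparing measures through shrinking windows\<close>

text \<open>
  Suppose that at every point of a set \<open>Z\<close> the windows of one common radius \<open>d\<close> satisfy an
  inequality between \<open>\<mu>\<close> and \<open>\<nu>\<close>. Cut the line into cells of length \<open>d\<close> and keep one window centred
  in \<open>Z\<close> for each cell that meets \<open>Z\<close>. These windows cover \<open>Z\<close>, and each lies in its own cell and the
  two adjacent ones, so that the inequality survives summation with the factor 3. The set \<open>Z\<close> need
  not be measurable, whence the superset \<open>C\<close>.
\<close>

lemma window_cover_measure_le: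
  fixes \<mu> \<nu> :: "real measure" and Z K D :: "real set" and d c :: real
  assumes \<mu>: "finite_measure \<mu>" "sets \<mu> = sets borel"
    and \<nu>: "finite_measure \<nu>" "sets \<nu> = sets borel"
    and d: "d > 0" and c: "c \<ge> 0" and Z: "bounded Z"
    and K: "K \<in> sets borel" and D: "D \<in> sets borel"
    and near: "\<And>\<theta>. \<theta> \<in> Z \<Longrightarrow> {\<theta> - d..\<theta> + d} - K \<subseteq> D"
    and le: "\<And>\<theta>. \<theta> \<in> Z \<Longrightarrow>
      measure \<mu> ({\<theta> - d..\<theta> + d} \<inter> K) \<le> c * measure \<nu> ({\<theta> - d..\<theta> + d} - K)"
  obtains C where "C \<in> sets borel" "Z \<subseteq> C" "measure \<mu> (C \<inter> K) \<le> 3 * c * measure \<nu> D"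
proof -
  interpret \<mu>: finite_measure \<mu> by fact
  interpret \<nu>: finite_measure \<nu> by fact
  define q :: "real \<Rightarrow> int" where "q z = \<lfloor>z / d\<rfloor>" for z
  define J where "J = q ` Z"
  have finJ: "finite J"
  proof -
    obtain R where R: "\<And>z. z \<in> Z \<Longrightarrow> \<bar>z\<bar> \<le> R"
      using Z by (auto simp: bounded_iff)
    have "J \<subseteq> {\<lfloor>- R / d\<rfloor>..\<lfloor>R / d\<rfloor>}"
      unfolding J_def q_def
    proof (intro image_subsetI)
      fix z assume "z \<in> Z"
      then have "- R \<le> z" "z \<le> R" using R[of z] by auto
      then show "\<lfloor>z / d\<rfloor> \<in> {\<lfloor>- R / d\<rfloor>..\<lfloor>R / d\<rfloor>}"
        using d by (auto intro!: floor_mono divide_right_mono simp del: minus_divide_left[symmetric])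
    qed
    then show ?thesis by (rule finite_subset) simp
  qed
  obtain t where t: "\<And>k. k \<in> J \<Longrightarrow> t k \<in> Z \<and> q (t k) = k"
    using bchoice[of J "\<lambda>k z. z \<in> Z \<and> q z = k"] unfolding J_def by blast
  define W where "W k = {t k - d..t k + d}" for k
  define e where "e k = D \<inter> q -` {k}" for k
  have q_meas: "q -` {k} \<in> sets borel" for k
  proof -
    have "q -` {k} = {of_int k * d ..< of_int (k + 1) * d}"
    proof (intro set_eqI)
      fix x
      have "q x = k \<longleftrightarrow> of_int k \<le> x / d \<and> x / d < of_int k + 1"
        unfolding q_def by (rule floor_eq_iff)
      also have "\<dots> \<longleftrightarrow> of_int k * d \<le> x \<and> x < of_int (k + 1) * d"
        using d by (simp add: pos_le_divide_eq pos_divide_less_eq)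
      finally show "x \<in> q -` {k} \<longleftrightarrow> x \<in> {of_int k * d ..< of_int (k + 1) * d}" by simp
    qed
    then show ?thesis by simp
  qed
  have e_meas: "e k \<in> sets \<nu>" for k
    using D q_meas \<nu>(2) by (auto simp: e_def)
  have W_sub: "W k - K \<subseteq> e (k - 1) \<union> e k \<union> e (k + 1)" if k: "k \<in> J" for k
  proof
    fix z assume z: "z \<in> W k - K"
    then have "z \<in> D" using near[of "t k"] t[OF k] by (auto simp: W_def subset_eq)
    have "t k / d - 1 \<le> z / d" "z / d \<le> t k / d + 1"
      using z divide_right_mono[of "t k - d" z d] divide_right_mono[of z "t k + d" d] d
      by (auto simp: W_def diff_divide_distrib add_divide_distrib)
    moreover have "of_int k \<le> t k / d" "t k / d < of_int k + 1"
      using t[OF k] by (auto simp: q_def floor_eq_iff)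
    ultimately have "q z = k - 1 \<or> q z = k \<or> q z = k + 1"
      unfolding q_def by linarith
    then show "z \<in> e (k - 1) \<union> e k \<union> e (k + 1)"
      using \<open>z \<in> D\<close> by (auto simp: e_def)
  qed
  have shifted: "(\<Sum>k\<in>J. measure \<nu> (e (k + s))) \<le> measure \<nu> D" for s
  proof -
    have "(\<Sum>k\<in>J. measure \<nu> (e (k + s))) = measure \<nu> (\<Union>k\<in>J. e (k + s))"
      using finJ e_meas
      by (intro \<nu>.finite_measure_finite_Union[symmetric])
        (auto simp: disjoint_family_on_def e_def)
    also have "\<dots> \<le> measure \<nu> D"
      using D \<nu>(2) by (intro \<nu>.finite_measure_mono) (auto simp: e_def)
    finally show ?thesis .
  qed
  show thesis
  proof
    show "(\<Union>k\<in>J. W k) \<in> sets borel"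
      using finJ by (auto simp: W_def)
    show "Z \<subseteq> (\<Union>k\<in>J. W k)"
    proof
      fix z assume z: "z \<in> Z"
      then have k: "q z \<in> J" by (simp add: J_def)
      have "\<lfloor>t (q z) / d\<rfloor> = \<lfloor>z / d\<rfloor>" using t[OF k] by (simp add: q_def)
      then have "\<bar>z / d - t (q z) / d\<bar> \<le> 1" by linarith
      then have "\<bar>z - t (q z)\<bar> \<le> d" using d by (simp add: diff_divide_distrib[symmetric])
      then have "z \<in> W (q z)" by (auto simp: W_def)
      then show "z \<in> (\<Union>k\<in>J. W k)" using k by blast
    qed
    have "measure \<mu> ((\<Union>k\<in>J. W k) \<inter> K) = measure \<mu> (\<Union>k\<in>J. W k \<inter> K)"
      by (rule arg_cong[where f="measure \<mu>"]) auto
    also have "\<dots> \<le> (\<Sum>k\<in>J. measure \<mu> (W k \<inter> K))"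
      using finJ K \<mu>(2) by (intro measure_UNION_le) (auto simp: W_def)
    also have "\<dots> \<le> (\<Sum>k\<in>J. c * measure \<nu> (W k - K))"
      using le t by (intro sum_mono) (auto simp: W_def)
    also have "\<dots> \<le> (\<Sum>k\<in>J. c * (measure \<nu> (e (k + - 1)) + measure \<nu> (e (k + 0)) + measure \<nu> (e (k + 1))))"
    proof (intro sum_mono mult_left_mono c)
      fix k assume k: "k \<in> J"
      have "measure \<nu> (W k - K) \<le> measure \<nu> (e (k - 1) \<union> e k \<union> e (k + 1))"
        using e_meas W_sub[OF k] by (intro \<nu>.finite_measure_mono) auto
      also have "\<dots> \<le> measure \<nu> (e (k - 1) \<union> e k) + measure \<nu> (e (k + 1))"
        using e_meas by (intro measure_Un_le) auto
      also have "\<dots> \<le> measure \<nu> (e (k - 1)) + measure \<nu> (e k) + measure \<nu> (e (k + 1))"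
        using e_meas by (intro add_right_mono measure_Un_le) auto
      finally show "measure \<nu> (W k - K) \<le>
          measure \<nu> (e (k + - 1)) + measure \<nu> (e (k + 0)) + measure \<nu> (e (k + 1))" by simp
    qed
    also have "\<dots> = c * ((\<Sum>k\<in>J. measure \<nu> (e (k + - 1))) + (\<Sum>k\<in>J. measure \<nu> (e (k + 0)))
        + (\<Sum>k\<in>J. measure \<nu> (e (k + 1))))"
      by (simp only: sum_distrib_left[symmetric] sum.distrib)
    also have "\<dots> \<le> c * (measure \<nu> D + measure \<nu> D + measure \<nu> D)"
      by (intro mult_left_mono add_mono shifted c)
    finally show "measure \<mu> ((\<Union>k\<in>J. W k) \<inter> K) \<le> 3 * c * measure \<nu> D" by simp
  qed
qed

text \<open>
  A differentiation theorem with a sharp constant: if at every point of \<open>A\<close> the closed symmetric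
  windows eventually satisfy \<open>\<mu> \<le> c * \<nu>\<close>, then so does \<open>A\<close>. The radius from which on the
  inequality holds may depend on the point.

  Fix \<open>c' > c\<close> and let \<open>Y\<close> be a Hahn set on whose subsets \<open>c' * \<nu> \<le> \<mu>\<close>. For a compact
  \<open>K \<subseteq> A \<inter> Y\<close> and a window \<open>W\<close> that satisfies the inequality,
  \<open>\<mu> (W \<inter> K) \<le> c * \<nu> (W \<inter> K) + c * \<nu> (W - K) \<le> c / c' * \<mu> (W \<inter> K) + c * \<nu> (W - K)\<close>, so
  \<open>\<mu> (W \<inter> K)\<close> is at most a constant times \<open>\<nu> (W - K)\<close>. By the covering lemma the points of \<open>K\<close> with
  a common admissible radius have measure at most a constant times that of a small neighbourhood of
  \<open>K\<close> with \<open>K\<close> removed, which tends to 0. Hence \<open>\<mu> K = 0\<close>, by inner regularity \<open>\<mu> (A \<inter> Y) = 0\<close>, and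
  off \<open>Y\<close> the inequality holds with \<open>c'\<close>.
\<close>

lemma measure_le_if_windows_le:
  fixes \<mu> \<nu> :: "real measure" and A :: "real set" and c :: real
  assumes \<mu>: "finite_measure \<mu>" "sets \<mu> = sets borel"
    and \<nu>: "finite_measure \<nu>" "sets \<nu> = sets borel"
    and A: "A \<in> sets borel" and c: "c \<ge> 0"
    and le: "\<And>\<theta>. \<theta> \<in> A \<Longrightarrow>
      \<forall>\<^sub>F \<delta> in at_right 0. measure \<mu> {\<theta> - \<delta>..\<theta> + \<delta>} \<le> c * measure \<nu> {\<theta> - \<delta>..\<theta> + \<delta>}"
  shows "measure \<mu> A \<le> c * measure \<nu> A"
proof -
  interpret \<mu>: finite_measure \<mu> by fact
  interpret \<nu>: finite_measure \<nu> by fact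
  have sp: "space \<mu> = UNIV" "space \<nu> = UNIV"
    using sets_eq_imp_space_eq[OF \<mu>(2)] sets_eq_imp_space_eq[OF \<nu>(2)] by simp_all
  have *: "measure \<mu> A \<le> c' * measure \<nu> A" if c': "c' > c" for c'
  proof -
    have c'0: "c' > 0" using c c' by simp
    obtain Y where Y: "Y \<in> sets borel"
      and Y1: "\<And>B. B \<in> sets borel \<Longrightarrow> B \<subseteq> Y \<Longrightarrow> c' * measure \<nu> B \<le> measure \<mu> B"
      and Y2: "\<And>B. B \<in> sets borel \<Longrightarrow> B \<inter> Y = {} \<Longrightarrow> measure \<mu> B \<le> c' * measure \<nu> B"
    proof -
      have fin: "finite_measure (scale_measure (ennreal c') \<nu>)"
        by (rule finite_measureI)
          (simp add: space_scale_measure \<nu>.emeasure_eq_measure ennreal_mult_eq_top_iff)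
      have em: "emeasure (scale_measure (ennreal c') \<nu>) B = ennreal (c' * measure \<nu> B)" for B
        using c'0 by (simp add: \<nu>.emeasure_eq_measure ennreal_mult)
      obtain Y where Y: "Y \<in> sets \<mu>"
        and Y1: "\<forall>B\<in>sets \<mu>. B \<subseteq> Y \<longrightarrow> emeasure (scale_measure (ennreal c') \<nu>) B \<le> emeasure \<mu> B"
        and Y2: "\<forall>B\<in>sets \<mu>. B \<inter> Y = {} \<longrightarrow> emeasure \<mu> B \<le> emeasure (scale_measure (ennreal c') \<nu>) B"
        using finite_unsigned_Hahn_decomposition[OF \<mu>(1) fin] \<mu>(2) \<nu>(2) by auto
      show thesis
      proof (rule that)
        show "Y \<in> sets borel" using Y \<mu>(2) by simp
        show "c' * measure \<nu> B \<le> measure \<mu> B" if "B \<in> sets borel" "B \<subseteq> Y" for B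
          using Y1[unfolded em \<mu>.emeasure_eq_measure] that \<mu>(2) by simp
        show "measure \<mu> B \<le> c' * measure \<nu> B" if "B \<in> sets borel" "B \<inter> Y = {}" for B
          using Y2[unfolded em \<mu>.emeasure_eq_measure] that \<mu>(2) c'0 by simp
      qed
    qed
    have null: "measure \<mu> K = 0" if K: "compact K" "K \<subseteq> A \<inter> Y" for K
    proof (cases "K = {}")
      case False
      have Kb: "K \<in> sets borel" and Kc: "closed K"
        using K by (auto simp: borel_compact compact_imp_closed)
      \<comment> \<open>\<open>G m\<close>: the points of \<open>K\<close> at which every radius below \<open>1 / (m + 1)\<close> is admissible.\<close>
      define G where "G m = {\<theta>\<in>K. \<forall>\<delta>. 0 < \<delta> \<and> \<delta> < inverse (real (Suc m)) \<longrightarrow>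
        measure \<mu> {\<theta> - \<delta>..\<theta> + \<delta>} \<le> c * measure \<nu> {\<theta> - \<delta>..\<theta> + \<delta>}}" for m
      have KG: "K \<subseteq> (\<Union>m. G m)"
      proof
        fix \<theta> assume \<theta>: "\<theta> \<in> K"
        then obtain b where b: "b > 0" "\<And>\<delta>. 0 < \<delta> \<Longrightarrow> \<delta> < b \<Longrightarrow>
            measure \<mu> {\<theta> - \<delta>..\<theta> + \<delta>} \<le> c * measure \<nu> {\<theta> - \<delta>..\<theta> + \<delta>}"
          using le[of \<theta>] K(2) by (auto simp: eventually_at_right_field)
        obtain m where "inverse (real (Suc m)) < b"
          using reals_Archimedean[OF b(1)] by blast
        then have "\<theta> \<in> G m" using \<theta> b(2) by (auto simp: G_def)
        then show "\<theta> \<in> (\<Union>m. G m)" by blast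
      qed
      \<comment> \<open>The inequality \<open>t \<le> c * (t / c' + s)\<close> gives \<open>t \<le> c2 * s\<close>.\<close>
      define c2 where "c2 = c * c' / (c' - c)"
      have c2: "c2 \<ge> 0" using c c' by (simp add: c2_def)
      define D where "D i = {x. infdist x K \<le> inverse (real (Suc i))} - K" for i
      have Db: "D i \<in> sets borel" for i
        unfolding D_def by (intro sets.Diff Kb borel_closed closed_Collect_le continuous_intros)
      have D0: "(\<lambda>i. measure \<nu> (D i)) \<longlonglongrightarrow> 0"
      proof -
        have "decseq D"
          unfolding decseq_def D_def
        proof (intro allI impI Diff_mono order_refl Collect_mono)
          fix m n :: nat and x assume mn: "m \<le> n" and x: "infdist x K \<le> inverse (real (Suc n))"
          have "inverse (real (Suc n)) \<le> inverse (real (Suc m))"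
            using mn by (intro le_imp_inverse_le) auto
          with x show "infdist x K \<le> inverse (real (Suc m))" by (rule order_trans)
        qed
        then have "(\<lambda>i. measure \<nu> (D i)) \<longlonglongrightarrow> measure \<nu> (\<Inter>i. D i)"
          using Db \<nu>(2) by (intro \<nu>.finite_Lim_measure_decseq) auto
        moreover have "(\<Inter>i. D i) = {}"
        proof -
          have "x \<in> K" if x: "\<And>i. infdist x K \<le> inverse (real (Suc i))" for x
          proof -
            have "infdist x K \<le> 0"
              by (rule tendsto_lowerbound[OF LIMSEQ_inverse_real_of_nat always_eventually]) (use x in blast, simp)
            then have "infdist x K = 0" using infdist_nonneg[of x K] by simp
            then show ?thesis using in_closed_iff_infdist_zero[OF Kc False] by simp
          qed
          then show ?thesis unfolding D_def by blast
        qed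
        ultimately show ?thesis by simp
      qed
      have ex: "\<exists>C. C \<in> sets borel \<and> G m \<subseteq> C \<and> measure \<mu> (C \<inter> K) \<le> 3 * c2 * measure \<nu> (D i)"
        if im: "i > m" for m i
      proof -
        define d where "d = inverse (real (Suc i))"
        have d: "d > 0" "d < inverse (real (Suc m))"
          using im by (auto simp: d_def intro!: less_imp_inverse_less)
        have bdd: "bounded (G m)"
          by (rule bounded_subset[OF compact_imp_bounded[OF K(1)]]) (auto simp: G_def)
        have near: "{\<theta> - d..\<theta> + d} - K \<subseteq> D i" if \<theta>: "\<theta> \<in> G m" for \<theta>
        proof
          fix x assume x: "x \<in> {\<theta> - d..\<theta> + d} - K"
          then have "dist x \<theta> \<le> d" by (auto simp: dist_real_def)
          then have "infdist x K \<le> d" using infdist_le2[of \<theta> K x d] \<theta> by (simp add: G_def)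
          then show "x \<in> D i" using x by (auto simp: D_def d_def)
        qed
        have wle: "measure \<mu> ({\<theta> - d..\<theta> + d} \<inter> K) \<le> c2 * measure \<nu> ({\<theta> - d..\<theta> + d} - K)"
          if \<theta>: "\<theta> \<in> G m" for \<theta>
        proof -
          define W where "W = {\<theta> - d..\<theta> + d}"
          have W: "W \<in> sets borel" by (simp add: W_def)
          have "measure \<mu> (W \<inter> K) \<le> measure \<mu> W"
            using W \<mu>(2) by (intro \<mu>.finite_measure_mono) auto
          also have "\<dots> \<le> c * measure \<nu> W"
            using \<theta> d by (auto simp: G_def W_def)
          finally have 1: "measure \<mu> (W \<inter> K) \<le> c * measure \<nu> W" .
          have 2: "measure \<nu> W = measure \<nu> (W \<inter> K) + measure \<nu> (W - K)"
            using W Kb \<nu>(2) by (subst \<nu>.finite_measure_Union[symmetric]) (auto intro!: arg_cong[where f="measure \<nu>"])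
          have 3: "measure \<nu> (W \<inter> K) \<le> measure \<mu> (W \<inter> K) / c'"
            using Y1[of "W \<inter> K"] W Kb K(2) c'0 by (auto simp: field_simps)
          have "c * measure \<nu> W \<le> c * (measure \<mu> (W \<inter> K) / c' + measure \<nu> (W - K))"
            using 2 3 c by (intro mult_left_mono) auto
          with 1 have "measure \<mu> (W \<inter> K) \<le> c * (measure \<mu> (W \<inter> K) / c' + measure \<nu> (W - K))"
            by linarith
          then have "measure \<mu> (W \<inter> K) \<le> c2 * measure \<nu> (W - K)"
            using c'0 c' by (simp add: c2_def field_simps)
          then show ?thesis
            by (simp add: W_def)
        qed
        show ?thesis
          by (rule window_cover_measure_le[OF \<mu> \<nu> d(1) c2 bdd Kb Db near wle]) auto
      qed
      have "\<exists>N. N \<in> sets borel \<and> G m \<subseteq> N \<and> measure \<mu> (N \<inter> K) = 0" for m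
      proof -
        obtain C where C: "\<And>i. i > m \<Longrightarrow> C i \<in> sets borel \<and> G m \<subseteq> C i \<and>
            measure \<mu> (C i \<inter> K) \<le> 3 * c2 * measure \<nu> (D i)"
          using ex[of m] by metis
        define N where "N = (\<Inter>i\<in>{m<..}. C i)"
        have N: "N \<in> sets borel" unfolding N_def using C by (intro sets.countable_INT) auto
        have "measure \<mu> (N \<inter> K) \<le> 3 * c2 * measure \<nu> (D i)" if "i > m" for i
        proof -
          have "measure \<mu> (N \<inter> K) \<le> measure \<mu> (C i \<inter> K)"
            using C[OF that] that Kb \<mu>(2) by (intro \<mu>.finite_measure_mono) (auto simp: N_def)
          then show ?thesis using C[OF that] by simp
        qed
        then have "measure \<mu> (N \<inter> K) \<le> 3 * c2 * 0"
          by (intro tendsto_lowerbound[OF tendsto_mult[OF tendsto_const D0]])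
            (auto intro!: eventually_sequentiallyI[of "Suc m"])
        then have "measure \<mu> (N \<inter> K) = 0" using measure_nonneg[of \<mu> "N \<inter> K"] by simp
        then show ?thesis using N C by (auto simp: N_def)
      qed
      then obtain N where N: "\<And>m. N m \<in> sets borel" "\<And>m. G m \<subseteq> N m" "\<And>m. measure \<mu> (N m \<inter> K) = 0"
        by metis
      have "(\<Union>m. N m \<inter> K) \<in> null_sets \<mu>"
        using N Kb \<mu>(2) by (intro null_sets_UN) (auto simp: null_sets_def \<mu>.emeasure_eq_measure)
      then have "measure \<mu> (\<Union>m. N m \<inter> K) = 0" by (rule measure_eq_0_null_sets)
      moreover have "(\<Union>m. N m \<inter> K) = K" using KG N(2) by blast
      ultimately show ?thesis by simp
    qed simp
    have "measure \<mu> (A \<inter> Y) = 0"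
    proof -
      have "emeasure \<mu> (A \<inter> Y) = (SUP K\<in>{K. K \<subseteq> A \<inter> Y \<and> compact K}. emeasure \<mu> K)"
        using A Y \<mu> sp by (intro inner_regular) auto
      also have "\<dots> \<le> 0"
        using null by (intro SUP_least) (auto simp: \<mu>.emeasure_eq_measure)
      finally show ?thesis by (simp add: \<mu>.emeasure_eq_measure)
    qed
    moreover have "measure \<mu> A = measure \<mu> (A \<inter> Y) + measure \<mu> (A - Y)"
      using A Y \<mu>(2)
      by (subst \<mu>.finite_measure_Union[symmetric]) (auto intro!: arg_cong[where f="measure \<mu>"])
    moreover have "measure \<mu> (A - Y) \<le> c' * measure \<nu> (A - Y)"
      using A Y by (intro Y2) auto
    moreover have "c' * measure \<nu> (A - Y) \<le> c' * measure \<nu> A"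
      using A Y \<nu>(2) c'0 by (intro mult_left_mono \<nu>.finite_measure_mono) auto
    ultimately show ?thesis by linarith
  qed
  show ?thesis
  proof (rule field_le_epsilon)
    fix e :: real assume e: "e > 0"
    define m where "m = measure \<nu> A"
    have m: "m \<ge> 0" by (simp add: m_def)
    have "measure \<mu> A \<le> (c + e / (m + 1)) * m"
      unfolding m_def by (rule *) (use e m in \<open>auto simp: m_def intro!: divide_pos_pos add_nonneg_pos\<close>)
    also have "\<dots> = c * m + e * (m / (m + 1))" by (simp add: algebra_simps)
    also have "\<dots> \<le> c * m + e * 1"
      using m e by (intro add_left_mono mult_left_mono) auto
    finally show "measure \<mu> A \<le> c * measure \<nu> A + e" by (simp add: m_def)
  qed
qed

section \<open>From conditional tails at a point to tails on sets of weights\<close>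

context prob_space begin

text \<open>
  The differentiation theorem for the measures \<open>I \<mapsto> \<P>(X > y, T \<in> I)\<close> and \<open>I \<mapsto> \<P>(X > y', T \<in> I)\<close>.
\<close>

lemma prob_Int_window_le:
  fixes X T :: "'a \<Rightarrow> real"
  assumes [measurable]: "random_variable borel X" "random_variable borel T"
  assumes c: "c \<ge> 0" and I: "I \<in> sets borel"
    and le: "\<And>\<theta>. \<theta> \<in> I \<Longrightarrow> \<forall>\<^sub>F \<delta> in at_right 0.
      \<P>(\<omega> in M. X \<omega> > y \<and> T \<omega> \<in> {\<theta> - \<delta>..\<theta> + \<delta>}) \<le>
      c * \<P>(\<omega> in M. X \<omega> > y' \<and> T \<omega> \<in> {\<theta> - \<delta>..\<theta> + \<delta>})"
  shows "\<P>(\<omega> in M. X \<omega> > y \<and> T \<omega> \<in> I) \<le> c * \<P>(\<omega> in M. X \<omega> > y' \<and> T \<omega> \<in> I)"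
proof -
  define N where "N y = distr (restrict_space M {\<omega>\<in>space M. X \<omega> > y}) borel T" for y
  have fin: "finite_measure (N y)" and sets_N: "sets (N y) = sets borel" for y
    unfolding N_def
    by (auto intro!: finite_measure.finite_measure_distr finite_measure_restrict_space measurable_restrict_space1)
  have N: "measure (N y) B = \<P>(\<omega> in M. X \<omega> > y \<and> T \<omega> \<in> B)" if "B \<in> sets borel" for y B
    unfolding N_def using that
    by (subst measure_distr)
      (auto simp: measure_restrict_space space_restrict_space intro!: measurable_restrict_space1 arg_cong[where f=prob])
  have "measure (N y) I \<le> c * measure (N y') I"
    using le by (intro measure_le_if_windows_le fin sets_N I c) (simp add: N)
  then show ?thesis using I by (simp add: N)
qed

lemma supp_nonneg:
  fixes T :: "'a \<Rightarrow> real"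
  assumes "AE \<omega> in M. T \<omega> \<ge> 0" "\<theta> \<in> supp M T" and [measurable]: "random_variable borel T"
  shows "\<theta> \<ge> 0"
proof (rule ccontr)
  assume "\<not> \<theta> \<ge> 0"
  then have "- \<theta> / 2 > 0" by simp
  then have "\<P>(\<omega> in M. T \<omega> \<in> {\<theta> - (- \<theta> / 2)..\<theta> + (- \<theta> / 2)}) > 0"
    using assms(2) unfolding supp_def by blast
  moreover have "\<P>(\<omega> in M. T \<omega> \<in> {\<theta> - (- \<theta> / 2)..\<theta> + (- \<theta> / 2)}) = 0"
    using \<open>\<not> \<theta> \<ge> 0\<close> assms(1) by (intro prob_eq_0_AE) auto
  ultimately show False by simp
qed

lemma not_supp_window_null:
  fixes T :: "'a \<Rightarrow> real"
  assumes "\<theta> \<notin> supp M T" and [measurable]: "random_variable borel T"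
  shows "\<forall>\<^sub>F \<delta> in at_right 0. \<P>(\<omega> in M. P \<omega> \<and> T \<omega> \<in> {\<theta> - \<delta>..\<theta> + \<delta>}) = 0"
proof -
  obtain d where d: "d > 0" "\<P>(\<omega> in M. T \<omega> \<in> {\<theta> - d..\<theta> + d}) \<le> 0"
    using assms(1) by (auto simp: supp_def not_less)
  show ?thesis
    unfolding eventually_at_right_field
  proof (intro exI[of _ d] conjI allI impI d(1))
    fix \<delta> assume "0 < \<delta>" "\<delta> < d"
    then have "\<P>(\<omega> in M. P \<omega> \<and> T \<omega> \<in> {\<theta> - \<delta>..\<theta> + \<delta>}) \<le> \<P>(\<omega> in M. T \<omega> \<in> {\<theta> - d..\<theta> + d})"
      by (intro finite_measure_mono) auto
    then show "\<P>(\<omega> in M. P \<omega> \<and> T \<omega> \<in> {\<theta> - \<delta>..\<theta> + \<delta>}) = 0"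
      using d(2) by (simp add: order_antisym measure_nonneg)
  qed
qed

text \<open>
  Every point outside the support has a null window, so the differentiation theorem with constant 0
  shows that the complement of the support carries no mass.
\<close>

lemma exists_pos_supp:
  fixes T :: "'a \<Rightarrow> real"
  assumes T: "random_variable borel T" and nn: "AE \<omega> in M. T \<omega> \<ge> 0"
    and nd: "\<not> (AE \<omega> in M. T \<omega> = 0)"
  shows "\<exists>\<theta>\<in>supp M T. \<theta> > 0"
proof (rule ccontr)
  assume "\<not> (\<exists>\<theta>\<in>supp M T. \<theta> > 0)"
  then have no: "\<theta> \<notin> supp M T" if "\<theta> > 0" for \<theta> using that by blast
  note [measurable] = T
  have "\<P>(\<omega> in M. 1 > (0::real) \<and> T \<omega> \<in> {0<..}) \<le> 0 * \<P>(\<omega> in M. 1 > (0::real) \<and> T \<omega> \<in> {0<..})"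
  proof (rule prob_Int_window_le)
    fix \<theta> :: real assume "\<theta> \<in> {0<..}"
    then show "\<forall>\<^sub>F \<delta> in at_right 0.
      \<P>(\<omega> in M. 1 > (0::real) \<and> T \<omega> \<in> {\<theta> - \<delta>..\<theta> + \<delta>}) \<le>
      0 * \<P>(\<omega> in M. 1 > (0::real) \<and> T \<omega> \<in> {\<theta> - \<delta>..\<theta> + \<delta>})"
      using not_supp_window_null[OF no T, of \<theta> "\<lambda>_. 1 > (0::real)"] by (auto elim: eventually_mono)
  qed auto
  then have "\<P>(\<omega> in M. T \<omega> > 0) = 0" by (simp add: order_antisym measure_nonneg)
  then have "AE \<omega> in M. \<not> T \<omega> > 0" by (subst (asm) prob_eq_0) (auto simp: AE_iff_measurable)
  with nn have "AE \<omega> in M. T \<omega> = 0" by eventually_elim auto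
  with nd show False by blast
qed

lemma cprob_tendsto:
  assumes "cprob_exists M A T \<theta>"
  shows "((\<lambda>\<delta>. \<P>(\<omega> in M. A \<omega> \<bar> T \<omega> \<in> {\<theta> - \<delta>..\<theta> + \<delta>})) \<longlongrightarrow> cprob M A T \<theta>) (at_right 0)"
  using assms unfolding cprob_exists_def cprob_def
  by (auto simp: tendsto_Lim)

text \<open>
  The uniform asymptotics \<open>\<P>(X > x | T = \<theta>) \<sim> h \<theta> * \<P>(X > x)\<close> in integrated form: up to a factor
  \<open>1 + \<eta>\<close>, the conditional distribution of \<open>T\<close> given \<open>X > y\<close> does not depend on the level \<open>y\<close>
  once \<open>y\<close> is large, simultaneously for all Borel sets of weights. Comparing two levels with each
  other eliminates \<open>h\<close>, for which no measurability is needed. Off the support both sides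
  vanish on small windows.
\<close>

lemma cprob_tail_comparison:
  fixes X T :: "'a \<Rightarrow> real" and h :: "real \<Rightarrow> real"
  assumes X: "random_variable borel X" and T: "random_variable borel T"
    and nn: "AE \<omega> in M. T \<omega> \<ge> 0"
    and tail_pos: "\<And>x. \<P>(\<omega> in M. X \<omega> > x) > 0"
    and h_pos: "\<And>\<theta>. \<theta> \<ge> 0 \<Longrightarrow> h \<theta> > 0"
    and ex: "\<forall>\<^sub>F x in at_top. \<forall>\<theta>\<in>supp M T. cprob_exists M (\<lambda>\<omega>. X \<omega> > x) T \<theta>"
    and equiv: "unif_asymp_equiv (supp M T) at_top
        (\<lambda>x \<theta>. cprob M (\<lambda>\<omega>. X \<omega> > x) T \<theta>) (\<lambda>x \<theta>. h \<theta> * \<P>(\<omega> in M. X \<omega> > x))"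
    and \<eta>: "\<eta> > 0"
  shows "\<exists>y0. \<forall>y\<ge>y0. \<forall>y'\<ge>y0. \<forall>I\<in>sets borel.
    \<P>(\<omega> in M. X \<omega> > y \<and> T \<omega> \<in> I) * \<P>(\<omega> in M. X \<omega> > y') \<le>
    (1 + \<eta>) * \<P>(\<omega> in M. X \<omega> > y' \<and> T \<omega> \<in> I) * \<P>(\<omega> in M. X \<omega> > y)"
proof -
  define F where "F y = \<P>(\<omega> in M. X \<omega> > y)" for y
  define C where "C y \<theta> = cprob M (\<lambda>\<omega>. X \<omega> > y) T \<theta>" for y \<theta>
  have F: "F y > 0" for y using tail_pos by (simp add: F_def)
  \<comment> \<open>Chosen such that \<open>1 + \<epsilon> \<le> (1 + \<eta>) * (1 - \<epsilon>)\<close>.\<close>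
  define \<epsilon> where "\<epsilon> = \<eta> / (3 + \<eta>)"
  have \<epsilon>: "\<epsilon> > 0" using \<eta> by (simp add: \<epsilon>_def)
  have "\<forall>\<^sub>F x in at_top. \<forall>\<theta>\<in>supp M T. cprob_exists M (\<lambda>\<omega>. X \<omega> > x) T \<theta> \<and>
      dist (if C x \<theta> = 0 \<and> h \<theta> * F x = 0 then 1 else C x \<theta> / (h \<theta> * F x)) 1 < \<epsilon>"
    using ex equiv[unfolded unif_asymp_equiv_def uniform_limit_iff, rule_format, OF \<epsilon>]
    unfolding F_def C_def by eventually_elim blast
  then obtain y0 :: real where y0: "\<And>x \<theta>. x \<ge> y0 \<Longrightarrow> \<theta> \<in> supp M T \<Longrightarrow> cprob_exists M (\<lambda>\<omega>. X \<omega> > x) T \<theta> \<and>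
      dist (if C x \<theta> = 0 \<and> h \<theta> * F x = 0 then 1 else C x \<theta> / (h \<theta> * F x)) 1 < \<epsilon>"
    unfolding eventually_at_top_linorder by blast
  have bounds: "(1 - \<epsilon>) * (h \<theta> * F x) < C x \<theta>" "C x \<theta> < (1 + \<epsilon>) * (h \<theta> * F x)"
    and h: "h \<theta> > 0"
    if "x \<ge> y0" "\<theta> \<in> supp M T" for x \<theta>
  proof -
    show h: "h \<theta> > 0" using h_pos supp_nonneg[OF nn that(2) T] by blast
    then have hF: "h \<theta> * F x > 0" using F by simp
    then have "h \<theta> * F x \<noteq> 0" by linarith
    then have "\<bar>C x \<theta> / (h \<theta> * F x) - 1\<bar> < \<epsilon>"
      using y0[OF that] by (simp only: dist_real_def simp_thms if_False)
    then have "1 - \<epsilon> < C x \<theta> / (h \<theta> * F x)" "C x \<theta> / (h \<theta> * F x) < 1 + \<epsilon>" by linarith+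
    then show "(1 - \<epsilon>) * (h \<theta> * F x) < C x \<theta>" "C x \<theta> < (1 + \<epsilon>) * (h \<theta> * F x)"
      using hF by (simp_all add: pos_less_divide_eq pos_divide_less_eq)
  qed
  show ?thesis
  proof (intro exI[of _ y0] allI impI ballI)
    fix y y' :: real and I :: "real set"
    assume y: "y \<ge> y0" "y' \<ge> y0" and I: "I \<in> sets borel"
    define c where "c = (1 + \<eta>) * F y / F y'"
    have c: "c \<ge> 0" using F[of y] F[of y'] \<eta> by (simp add: c_def)
    have "\<P>(\<omega> in M. X \<omega> > y \<and> T \<omega> \<in> I) \<le> c * \<P>(\<omega> in M. X \<omega> > y' \<and> T \<omega> \<in> I)"
    proof (rule prob_Int_window_le[OF X T c I])
      fix \<theta>
      show "\<forall>\<^sub>F \<delta> in at_right 0.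
        \<P>(\<omega> in M. X \<omega> > y \<and> T \<omega> \<in> {\<theta> - \<delta>..\<theta> + \<delta>}) \<le>
        c * \<P>(\<omega> in M. X \<omega> > y' \<and> T \<omega> \<in> {\<theta> - \<delta>..\<theta> + \<delta>})"
      proof (cases "\<theta> \<in> supp M T")
        case False
        show ?thesis
          using not_supp_window_null[OF False T, of "\<lambda>\<omega>. X \<omega> > y"]
          by eventually_elim (use c in simp)
      next
        case True
        have hh: "h \<theta> > 0" using h[OF y(1) True] .
        have "C y \<theta> < (1 + \<epsilon>) * (h \<theta> * F y)" using bounds[OF y(1) True] by simp
        also have "1 + \<epsilon> \<le> (1 + \<eta>) * (1 - \<epsilon>)"
          using \<eta> by (simp add: \<epsilon>_def field_simps)
        then have "(1 + \<epsilon>) * (h \<theta> * F y) \<le> (1 + \<eta>) * (1 - \<epsilon>) * (h \<theta> * F y)"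
          using hh F[of y] by (intro mult_right_mono) auto
        also have "\<dots> = c * ((1 - \<epsilon>) * (h \<theta> * F y'))"
          using F[of y'] by (simp add: c_def)
        also have "\<dots> \<le> c * C y' \<theta>"
          using bounds[OF y(2) True] c by (intro mult_left_mono) auto
        finally have less: "0 < c * C y' \<theta> - C y \<theta>" by simp
        have "((\<lambda>\<delta>. c * \<P>(\<omega> in M. X \<omega> > y' \<bar> T \<omega> \<in> {\<theta> - \<delta>..\<theta> + \<delta>})
            - \<P>(\<omega> in M. X \<omega> > y \<bar> T \<omega> \<in> {\<theta> - \<delta>..\<theta> + \<delta>})) \<longlongrightarrow> c * C y' \<theta> - C y \<theta>) (at_right 0)"
          unfolding C_def using y0[OF y(1) True] y0[OF y(2) True]
          by (intro tendsto_intros cprob_tendsto) auto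
        then have "\<forall>\<^sub>F \<delta> in at_right 0. 0 < c * \<P>(\<omega> in M. X \<omega> > y' \<bar> T \<omega> \<in> {\<theta> - \<delta>..\<theta> + \<delta>})
            - \<P>(\<omega> in M. X \<omega> > y \<bar> T \<omega> \<in> {\<theta> - \<delta>..\<theta> + \<delta>})"
          using less by (rule order_tendstoD(1))
        moreover have "\<forall>\<^sub>F \<delta> in at_right 0. \<delta> > (0::real)" by (rule eventually_at_right_less)
        ultimately show ?thesis
        proof eventually_elim
          fix \<delta> :: real assume \<delta>: "\<delta> > 0"
            and less: "0 < c * \<P>(\<omega> in M. X \<omega> > y' \<bar> T \<omega> \<in> {\<theta> - \<delta>..\<theta> + \<delta>})
            - \<P>(\<omega> in M. X \<omega> > y \<bar> T \<omega> \<in> {\<theta> - \<delta>..\<theta> + \<delta>})"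
          have pos: "\<P>(\<omega> in M. T \<omega> \<in> {\<theta> - \<delta>..\<theta> + \<delta>}) > 0"
            using True \<delta> unfolding supp_def by blast
          have "\<P>(\<omega> in M. X \<omega> > y \<and> T \<omega> \<in> {\<theta> - \<delta>..\<theta> + \<delta>}) / \<P>(\<omega> in M. T \<omega> \<in> {\<theta> - \<delta>..\<theta> + \<delta>})
             \<le> c * \<P>(\<omega> in M. X \<omega> > y' \<and> T \<omega> \<in> {\<theta> - \<delta>..\<theta> + \<delta>}) / \<P>(\<omega> in M. T \<omega> \<in> {\<theta> - \<delta>..\<theta> + \<delta>})"
            using less unfolding cond_prob_def times_divide_eq_right by linarith
          then show "\<P>(\<omega> in M. X \<omega> > y \<and> T \<omega> \<in> {\<theta> - \<delta>..\<theta> + \<delta>}) \<le>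
            c * \<P>(\<omega> in M. X \<omega> > y' \<and> T \<omega> \<in> {\<theta> - \<delta>..\<theta> + \<delta>})"
            using pos unfolding divide_le_cancel by blast
        qed
      qed
    qed
    then show "\<P>(\<omega> in M. X \<omega> > y \<and> T \<omega> \<in> I) * \<P>(\<omega> in M. X \<omega> > y') \<le>
      (1 + \<eta>) * \<P>(\<omega> in M. X \<omega> > y' \<and> T \<omega> \<in> I) * \<P>(\<omega> in M. X \<omega> > y)"
      using F[of y'] by (simp add: c_def F_def[symmetric] field_simps)
  qed
qed

text \<open>
  A positive support point \<open>\<theta>\<close> exists, and there the conditional tail is positive because \<open>h\<close> is;
  hence so is the joint probability of \<open>X > y\<close> and a window around \<open>\<theta>\<close>.
\<close>

lemma cprob_pos_window:
  fixes X T :: "'a \<Rightarrow> real" and h :: "real \<Rightarrow> real"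
  assumes X: "random_variable borel X" and T: "random_variable borel T"
    and nn: "AE \<omega> in M. T \<omega> \<ge> 0" and nd: "\<not> (AE \<omega> in M. T \<omega> = 0)"
    and tail_pos: "\<And>x. \<P>(\<omega> in M. X \<omega> > x) > 0"
    and h_pos: "\<And>\<theta>. \<theta> \<ge> 0 \<Longrightarrow> h \<theta> > 0"
    and ex: "\<forall>\<^sub>F x in at_top. \<forall>\<theta>\<in>supp M T. cprob_exists M (\<lambda>\<omega>. X \<omega> > x) T \<theta>"
    and equiv: "unif_asymp_equiv (supp M T) at_top
        (\<lambda>x \<theta>. cprob M (\<lambda>\<omega>. X \<omega> > x) T \<theta>) (\<lambda>x \<theta>. h \<theta> * \<P>(\<omega> in M. X \<omega> > x))"
  shows "\<exists>\<theta>0>0. \<forall>\<^sub>F y in at_top. \<P>(\<omega> in M. X \<omega> > y \<and> T \<omega> \<in> {\<theta>0..}) > 0"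
proof -
  note [measurable] = X T
  obtain \<theta> where \<theta>: "\<theta> \<in> supp M T" "\<theta> > 0" using exists_pos_supp[OF T nn nd] by blast
  have "\<forall>\<^sub>F x in at_top. cprob_exists M (\<lambda>\<omega>. X \<omega> > x) T \<theta> \<and>
      dist (if cprob M (\<lambda>\<omega>. X \<omega> > x) T \<theta> = 0 \<and> h \<theta> * \<P>(\<omega> in M. X \<omega> > x) = 0 then 1
        else cprob M (\<lambda>\<omega>. X \<omega> > x) T \<theta> / (h \<theta> * \<P>(\<omega> in M. X \<omega> > x))) 1 < 1"
    using ex equiv[unfolded unif_asymp_equiv_def uniform_limit_iff, rule_format, OF zero_less_one]
    by eventually_elim (use \<theta> in blast)
  then have "\<forall>\<^sub>F y in at_top. \<P>(\<omega> in M. X \<omega> > y \<and> T \<omega> \<in> {\<theta> / 2..}) > 0"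
  proof eventually_elim
    case (elim y)
    have hF: "h \<theta> * \<P>(\<omega> in M. X \<omega> > y) > 0" using h_pos[of \<theta>] \<theta> tail_pos[of y] by simp
    then have "h \<theta> * \<P>(\<omega> in M. X \<omega> > y) \<noteq> 0" by linarith
    then have "\<bar>cprob M (\<lambda>\<omega>. X \<omega> > y) T \<theta> / (h \<theta> * \<P>(\<omega> in M. X \<omega> > y)) - 1\<bar> < 1"
      using elim by (simp only: dist_real_def simp_thms if_False)
    then have "cprob M (\<lambda>\<omega>. X \<omega> > y) T \<theta> / (h \<theta> * \<P>(\<omega> in M. X \<omega> > y)) > 0" by linarith
    then have "cprob M (\<lambda>\<omega>. X \<omega> > y) T \<theta> > 0" using hF by (simp add: zero_less_divide_iff)
    with elim have "\<forall>\<^sub>F \<delta> in at_right 0. \<P>(\<omega> in M. X \<omega> > y \<bar> T \<omega> \<in> {\<theta> - \<delta>..\<theta> + \<delta>}) > 0"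
      by (intro order_tendstoD(1)[OF cprob_tendsto]) auto
    moreover have "\<forall>\<^sub>F \<delta> in at_right 0. \<delta> < \<theta> / 2"
      using \<theta>(2) by (intro eventually_at_rightI[of 0 "\<theta> / 2"]) auto
    ultimately have "\<forall>\<^sub>F \<delta> in at_right 0. \<delta> < \<theta> / 2 \<and>
        \<P>(\<omega> in M. X \<omega> > y \<bar> T \<omega> \<in> {\<theta> - \<delta>..\<theta> + \<delta>}) > 0"
      by eventually_elim blast
    then obtain \<delta> where \<delta>: "\<delta> < \<theta> / 2" "\<P>(\<omega> in M. X \<omega> > y \<bar> T \<omega> \<in> {\<theta> - \<delta>..\<theta> + \<delta>}) > 0"
      using eventually_happens'[OF trivial_limit_at_right_real] by blast
    then have "\<P>(\<omega> in M. X \<omega> > y \<and> T \<omega> \<in> {\<theta> - \<delta>..\<theta> + \<delta>}) \<noteq> 0"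
      by (auto simp: cond_prob_def)
    then have "0 < \<P>(\<omega> in M. X \<omega> > y \<and> T \<omega> \<in> {\<theta> - \<delta>..\<theta> + \<delta>})"
      by (simp add: zero_less_measure_iff)
    also have "\<dots> \<le> \<P>(\<omega> in M. X \<omega> > y \<and> T \<omega> \<in> {\<theta> / 2..})"
      using \<delta>(1) by (intro finite_measure_mono) auto
    finally show ?case .
  qed
  then show ?thesis using \<theta>(2) by (intro exI[of _ "\<theta> / 2"]) simp
qed

end

section \<open>Tails of a variable multiplied by a bounded weight\<close>

text \<open>
  A variable \<open>X\<close> with dominatedly varying tail and a weight \<open>T\<close> with values in \<open>[0, B]\<close> almost
  surely. The dependence between them enters only through two facts: the conditional distribution of
  \<open>T\<close> given \<open>X > y\<close> is asymptotically independent of \<open>y\<close> (\<open>comparison\<close>), and it charges some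
  interval away from 0 (\<open>weight_pos\<close>).
\<close>

locale bounded_weight = prob_space M for M :: "'a measure" +
  fixes X T :: "'a \<Rightarrow> real" and B :: real
  assumes X_rv [measurable]: "random_variable borel X"
    and T_rv [measurable]: "random_variable borel T"
    and B_pos: "B > 0"
    and T_bounds: "AE \<omega> in M. 0 \<le> T \<omega> \<and> T \<omega> \<le> B"
    and tail_pos: "\<And>x. \<P>(\<omega> in M. X \<omega> > x) > 0"
    and dominated: "\<And>b. 0 < b \<Longrightarrow> b < 1 \<Longrightarrow>
      \<exists>C>0. \<forall>\<^sub>F x in at_top. \<P>(\<omega> in M. X \<omega> > b * x) \<le> C * \<P>(\<omega> in M. X \<omega> > x)"
    and comparison: "\<And>\<eta>. \<eta> > 0 \<Longrightarrow> \<exists>y0. \<forall>y\<ge>y0. \<forall>y'\<ge>y0. \<forall>I\<in>sets borel.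
      \<P>(\<omega> in M. X \<omega> > y \<and> T \<omega> \<in> I) * \<P>(\<omega> in M. X \<omega> > y') \<le>
      (1 + \<eta>) * \<P>(\<omega> in M. X \<omega> > y' \<and> T \<omega> \<in> I) * \<P>(\<omega> in M. X \<omega> > y)"
    and weight_pos: "\<exists>\<theta>0>0. \<forall>\<^sub>F y in at_top. \<P>(\<omega> in M. X \<omega> > y \<and> T \<omega> \<in> {\<theta>0..}) > 0"
begin

text \<open>The tail of \<open>X\<close>.\<close>

definition F :: "real \<Rightarrow> real" where "F x = \<P>(\<omega> in M. X \<omega> > x)"

text \<open>The tail of the product \<open>T * X\<close>.\<close>

definition H :: "real \<Rightarrow> real" where "H x = \<P>(\<omega> in M. T \<omega> * X \<omega> > x)"

text \<open>The joint probability of \<open>X\<close> exceeding \<open>y\<close> and the weight lying in \<open>I\<close>.\<close>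

definition J :: "real \<Rightarrow> real set \<Rightarrow> real" where "J y I = \<P>(\<omega> in M. X \<omega> > y \<and> T \<omega> \<in> I)"

lemma F_pos: "F x > 0"
  using tail_pos by (simp add: F_def)

lemma F_antimono: "x \<le> y \<Longrightarrow> F y \<le> F x"
  unfolding F_def by (intro finite_measure_mono) auto

lemma J_comparison:
  assumes "\<eta> > 0"
  obtains y0 where "\<And>y y' I. y \<ge> y0 \<Longrightarrow> y' \<ge> y0 \<Longrightarrow> I \<in> sets borel \<Longrightarrow>
    J y I * F y' \<le> (1 + \<eta>) * J y' I * F y"
  using comparison[OF assms] unfolding J_def F_def by blast

lemma dominated_any:
  assumes "a > 0"
  shows "\<exists>C>0. \<forall>\<^sub>F x in at_top. F (a * x) \<le> C * F x"
proof (cases "a < 1")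
  case True
  then show ?thesis using dominated[OF assms] by (simp add: F_def)
next
  case False
  have "\<forall>\<^sub>F x in at_top. F (a * x) \<le> 1 * F x"
    using eventually_ge_at_top[of 0]
  proof eventually_elim
    case (elim x)
    then have "1 * x \<le> a * x" using False by (intro mult_right_mono) auto
    then show ?case using F_antimono by simp
  qed
  then show ?thesis by (intro exI[of _ 1]) simp
qed

text \<open>
  On the event \<open>T \<ge> \<theta>\<close>, which keeps a positive share of \<open>X > y\<close> as \<open>y\<close> grows, the product exceeds
  \<open>x\<close> as soon as \<open>X > x / \<theta>\<close>; dominated variation replaces \<open>x / \<theta>\<close> by \<open>x\<close>.
\<close>

lemma weighted_tail_lower: "\<exists>c>0. \<forall>\<^sub>F x in at_top. c * F x \<le> H x"
proof -
  obtain \<theta> where \<theta>: "\<theta> > 0" and ev: "\<forall>\<^sub>F y in at_top. J y {\<theta>..} > 0"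
    using weight_pos unfolding J_def by blast
  obtain y0 where y0: "\<And>y y' I. y \<ge> y0 \<Longrightarrow> y' \<ge> y0 \<Longrightarrow> I \<in> sets borel \<Longrightarrow>
      J y I * F y' \<le> (1 + 1) * J y' I * F y"
    using J_comparison[OF zero_less_one] by blast
  have "\<forall>\<^sub>F y in at_top. J y {\<theta>..} > 0 \<and> y \<ge> y0"
    using ev eventually_ge_at_top by (rule eventually_conj)
  then obtain y1 where y1: "J y1 {\<theta>..} > 0" "y1 \<ge> y0"
    using eventually_happens'[OF trivial_limit_at_top_linorder] by blast
  define c where "c = J y1 {\<theta>..} / (2 * F y1)"
  have c: "c > 0" using y1 F_pos by (simp add: c_def)
  have low: "c * F y \<le> J y {\<theta>..}" if "y \<ge> y0" for y
    using y0[OF y1(2) that, of "{\<theta>..}"] F_pos[of y1] by (simp add: c_def field_simps)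
  obtain C where C: "C > 0" "\<forall>\<^sub>F x in at_top. F (\<theta> * x) \<le> C * F x"
    using dominated_any[OF \<theta>] by blast
  have lim: "filterlim (\<lambda>x. x / \<theta>) at_top at_top"
    unfolding filterlim_at_top
  proof
    fix Z
    show "\<forall>\<^sub>F x in at_top. Z \<le> x / \<theta>"
      using eventually_ge_at_top[of "Z * \<theta>"] by eventually_elim (use \<theta> in \<open>simp add: pos_le_divide_eq\<close>)
  qed
  have "\<forall>\<^sub>F x in at_top. F (\<theta> * (x / \<theta>)) \<le> C * F (x / \<theta>)"
    using C(2) lim by (rule eventually_compose_filterlim)
  moreover have "\<forall>\<^sub>F x in at_top. y0 \<le> x / \<theta>"
    using lim by (simp add: filterlim_at_top)
  moreover have "\<forall>\<^sub>F x in at_top. (0::real) < x" by (rule eventually_gt_at_top)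
  ultimately have "\<forall>\<^sub>F x in at_top. c / C * F x \<le> H x"
  proof eventually_elim
    case (elim x)
    have "c / C * F x \<le> c / C * (C * F (x / \<theta>))"
      using elim \<theta> c C(1) by (intro mult_left_mono) auto
    also have "\<dots> = c * F (x / \<theta>)" using C(1) by simp
    also have "\<dots> \<le> J (x / \<theta>) {\<theta>..}" using low elim by blast
    also have "\<dots> \<le> H x"
      unfolding J_def H_def
    proof (intro finite_measure_mono subsetI)
      fix \<omega> assume "\<omega> \<in> {\<omega> \<in> space M. x / \<theta> < X \<omega> \<and> T \<omega> \<in> {\<theta>..}}"
      then have w: "\<omega> \<in> space M" "x / \<theta> < X \<omega>" "\<theta> \<le> T \<omega>" by auto
      have "x < \<theta> * X \<omega>" using w(2) \<theta> by (simp add: pos_divide_less_eq mult.commute)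
      moreover have "X \<omega> > 0" using w(2) elim(3) \<theta> by (meson divide_pos_pos less_trans)
      then have "\<theta> * X \<omega> \<le> T \<omega> * X \<omega>" using w(3) by (intro mult_right_mono) auto
      ultimately show "\<omega> \<in> {\<omega> \<in> space M. x < T \<omega> * X \<omega>}" using w(1) by simp
    qed measurable
    finally show ?case .
  qed
  then show ?thesis using c C(1) by (intro exI[of _ "c / C"]) simp
qed

lemma tail_le_weighted_tail:
  assumes "a > 0"
  shows "\<exists>C>0. \<forall>\<^sub>F x in at_top. F (a * x) \<le> C * H x"
proof -
  obtain C where C: "C > 0" "\<forall>\<^sub>F x in at_top. F (a * x) \<le> C * F x"
    using dominated_any[OF assms] by blast
  obtain c where c: "c > 0" "\<forall>\<^sub>F x in at_top. c * F x \<le> H x"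
    using weighted_tail_lower by blast
  have "\<forall>\<^sub>F x in at_top. F (a * x) \<le> C / c * H x"
    using C(2) c(2)
  proof eventually_elim
    case (elim x)
    have "C * F x = C / c * (c * F x)" using c by simp
    also have "\<dots> \<le> C / c * H x" using elim C c by (intro mult_left_mono) auto
    finally show ?case using elim by simp
  qed
  then show ?thesis using C c by (intro exI[of _ "C / c"]) simp
qed

lemma weighted_tail_pos: "\<forall>\<^sub>F x in at_top. H x > 0"
proof -
  obtain c where c: "c > 0" "\<forall>\<^sub>F x in at_top. c * F x \<le> H x"
    using weighted_tail_lower by blast
  from c(2) show ?thesis
    by eventually_elim (use c(1) F_pos in \<open>meson less_le_trans mult_pos_pos\<close>)
qed

text \<open>
  Weights at most \<open>\<epsilon>\<close> contribute a negligible share to the tail of the product: for \<open>\<epsilon> \<le> 1 / 2\<close> they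
  require \<open>X > x\<close> with a weight in \<open>{0<..\<epsilon>}\<close>, and the share of these weights given \<open>X > x\<close> vanishes
  with \<open>\<epsilon>\<close>. The level \<open>x'\<close> may be as low as \<open>x / 2\<close>, which leaves room for a shift or a rescaling.
\<close>

lemma small_weights:
  assumes \<eta>: "\<eta> > 0"
  shows "\<exists>\<epsilon>>0. \<forall>\<^sub>F x in at_top. \<forall>x'\<ge>x / 2. \<P>(\<omega> in M. T \<omega> * X \<omega> > x' \<and> T \<omega> \<le> \<epsilon>) \<le> \<eta> * H x"
proof -
  obtain y0 where y0: "\<And>y y' I. y \<ge> y0 \<Longrightarrow> y' \<ge> y0 \<Longrightarrow> I \<in> sets borel \<Longrightarrow>
      J y I * F y' \<le> (1 + 1) * J y' I * F y"
    using J_comparison[OF zero_less_one] by blast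
  obtain c where c: "c > 0" "\<forall>\<^sub>F x in at_top. c * F x \<le> H x"
    using weighted_tail_lower by blast
  define r where "r = \<eta> * c * F y0 / 2"
  have r: "r > 0" using \<eta> c F_pos by (simp add: r_def)
  define e where "e k = inverse (real (Suc (Suc k)))" for k
  have "(\<lambda>k. J y0 {0<..e k}) \<longlonglongrightarrow> 0"
  proof -
    define D where "D k = {\<omega>\<in>space M. X \<omega> > y0 \<and> T \<omega> \<in> {0<..e k}}" for k
    have [measurable]: "D k \<in> events" for k unfolding D_def by measurable
    have "decseq D"
    proof (rule decseq_SucI)
      fix k
      have "e (Suc k) \<le> e k" unfolding e_def by (intro le_imp_inverse_le) auto
      then show "D (Suc k) \<subseteq> D k" by (auto simp: D_def)
    qed
    then have "(\<lambda>k. prob (D k)) \<longlonglongrightarrow> prob (\<Inter>k. D k)"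
      by (intro finite_Lim_measure_decseq) auto
    moreover have "(\<Inter>k. D k) = {}"
    proof (rule ccontr)
      assume "(\<Inter>k. D k) \<noteq> {}"
      then obtain \<omega> where w: "\<And>k. \<omega> \<in> D k" by blast
      then have "T \<omega> > 0" by (auto simp: D_def)
      then obtain k where k: "inverse (real (Suc k)) < T \<omega>" using reals_Archimedean by blast
      have "e k \<le> inverse (real (Suc k))" unfolding e_def by (intro le_imp_inverse_le) auto
      moreover have "T \<omega> \<le> e k" using w[of k] by (auto simp: D_def)
      ultimately show False using k by linarith
    qed
    ultimately show ?thesis by (simp add: J_def D_def)
  qed
  then have "\<forall>\<^sub>F k in sequentially. J y0 {0<..e k} < r" using r by (rule order_tendstoD(2))
  then obtain k where k: "J y0 {0<..e k} < r"
    using eventually_happens'[OF sequentially_bot] by blast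
  define \<epsilon> where "\<epsilon> = e k"
  have \<epsilon>: "\<epsilon> > 0" "\<epsilon> \<le> 1 / 2"
    by (auto simp: \<epsilon>_def e_def field_simps)
  have "\<forall>\<^sub>F x in at_top. \<forall>x'\<ge>x / 2. \<P>(\<omega> in M. T \<omega> * X \<omega> > x' \<and> T \<omega> \<le> \<epsilon>) \<le> \<eta> * H x"
    using c(2) eventually_ge_at_top[of y0] eventually_gt_at_top[of 0]
  proof eventually_elim
    case (elim x)
    show ?case
    proof (intro allI impI)
      fix x' assume x': "x' \<ge> x / 2"
      have "\<P>(\<omega> in M. T \<omega> * X \<omega> > x' \<and> T \<omega> \<le> \<epsilon>) \<le> J x {0<..\<epsilon>}"
        unfolding J_def
      proof (rule finite_measure_mono_AE)
        show "AE \<omega> in M. \<omega> \<in> {\<omega>\<in>space M. T \<omega> * X \<omega> > x' \<and> T \<omega> \<le> \<epsilon>} \<longrightarrow>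
            \<omega> \<in> {\<omega>\<in>space M. X \<omega> > x \<and> T \<omega> \<in> {0<..\<epsilon>}}"
          using T_bounds
        proof eventually_elim
          fix \<omega> assume b: "0 \<le> T \<omega> \<and> T \<omega> \<le> B"
          show "\<omega> \<in> {\<omega>\<in>space M. T \<omega> * X \<omega> > x' \<and> T \<omega> \<le> \<epsilon>} \<longrightarrow>
            \<omega> \<in> {\<omega>\<in>space M. X \<omega> > x \<and> T \<omega> \<in> {0<..\<epsilon>}}"
          proof
            assume w: "\<omega> \<in> {\<omega>\<in>space M. T \<omega> * X \<omega> > x' \<and> T \<omega> \<le> \<epsilon>}"
            then have pos: "T \<omega> * X \<omega> > 0" using x' elim(3) by auto
            then have T0: "T \<omega> > 0" and X0: "X \<omega> > 0" using b by (auto simp: zero_less_mult_iff)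
            have "T \<omega> * X \<omega> \<le> 1 / 2 * X \<omega>"
              using w X0 \<epsilon> by (intro mult_right_mono) auto
            then have "X \<omega> > x" using w x' by auto
            then show "\<omega> \<in> {\<omega>\<in>space M. X \<omega> > x \<and> T \<omega> \<in> {0<..\<epsilon>}}" using w T0 by auto
          qed
        qed
      qed measurable
      also have "\<dots> \<le> 2 * J y0 {0<..\<epsilon>} * F x / F y0"
        using y0[OF elim(2) order_refl, of "{0<..\<epsilon>}"] F_pos[of y0] by (simp add: pos_le_divide_eq)
      also have "\<dots> \<le> 2 * r * F x / F y0"
        using k F_pos[of x] F_pos[of y0]
        by (intro divide_right_mono mult_right_mono) (auto simp: \<epsilon>_def)
      also have "\<dots> = \<eta> * (c * F x)"
        using F_pos[of y0] by (simp add: r_def)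
      also have "\<dots> \<le> \<eta> * H x" using elim(1) \<eta> by (intro mult_left_mono) auto
      finally show "\<P>(\<omega> in M. T \<omega> * X \<omega> > x' \<and> T \<omega> \<le> \<epsilon>) \<le> \<eta> * H x" .
    qed
  qed
  then show ?thesis using \<epsilon>(1) by blast
qed

text \<open>
  If, for nearby weights \<open>u \<le> v\<close>, the tail of \<open>X\<close> at \<open>x' / v\<close> is at most \<open>1 + \<eta>\<close> times that at
  \<open>x / u\<close>, then passing from level \<open>x\<close> to \<open>x'\<close> changes the tail of the product, restricted to weights
  above \<open>\<epsilon>\<close>, by a factor at most \<open>(1 + \<eta>)\<^sup>2\<close>. The interval \<open>{\<epsilon><..B}\<close> is cut into pieces of length at
  most \<open>w\<close>; on each piece the product is sandwiched between constant multiples of \<open>X\<close>, and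
  \<open>y0\<close> is a level beyond which the joint probabilities at different levels are comparable.
\<close>

lemma large_weights:
  assumes \<eta>: "\<eta> > 0" and w: "w > 0" and \<epsilon>: "\<epsilon> > 0" and x: "x > 0" "x' > 0"
    and y0: "\<And>y y' I. y \<ge> y0 \<Longrightarrow> y' \<ge> y0 \<Longrightarrow> I \<in> sets borel \<Longrightarrow>
      J y I * F y' \<le> (1 + \<eta>) * J y' I * F y"
    and large: "y0 \<le> x / B" "y0 \<le> x' / B"
    and ratio: "\<And>u v. \<epsilon> \<le> u \<Longrightarrow> u \<le> v \<Longrightarrow> v \<le> u + w \<Longrightarrow> v \<le> B \<Longrightarrow> F (x' / v) \<le> (1 + \<eta>) * F (x / u)"
  shows "\<P>(\<omega> in M. T \<omega> * X \<omega> > x' \<and> T \<omega> > \<epsilon>) \<le> (1 + \<eta>)\<^sup>2 * H x"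
proof -
  define v where "v k = min B (\<epsilon> + real k * w)" for k
  define Q where "Q z I = \<P>(\<omega> in M. T \<omega> * X \<omega> > z \<and> T \<omega> \<in> I)" for z I
  have piece: "Q x' {a<..d} \<le> (1 + \<eta>)\<^sup>2 * Q x {a<..d}"
    if ad: "\<epsilon> \<le> a" "a \<le> d" "d \<le> a + w" "d \<le> B" for a d
  proof -
    have a: "a > 0" and d: "d > 0" using ad \<epsilon> by auto
    have ya: "y0 \<le> x / a" and yd: "y0 \<le> x' / d"
    proof -
      have "x / B \<le> x / a" using a ad x by (intro divide_left_mono) auto
      then show "y0 \<le> x / a" using large by simp
      have "x' / B \<le> x' / d" using d ad x B_pos by (intro divide_left_mono) auto
      then show "y0 \<le> x' / d" using large by simp
    qed
    have "Q x' {a<..d} \<le> J (x' / d) {a<..d}"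
      unfolding Q_def J_def
    proof (intro finite_measure_mono subsetI)
      fix \<omega> assume "\<omega> \<in> {\<omega> \<in> space M. x' < T \<omega> * X \<omega> \<and> T \<omega> \<in> {a<..d}}"
      then have *: "\<omega> \<in> space M" "x' < T \<omega> * X \<omega>" "a < T \<omega>" "T \<omega> \<le> d" by auto
      have "X \<omega> > 0" using * x a by (smt (verit) mult_nonneg_nonpos)
      then have "T \<omega> * X \<omega> \<le> d * X \<omega>" using *(4) by (intro mult_right_mono) auto
      then have "x' / d < X \<omega>" using * d by (simp add: pos_divide_less_eq mult.commute)
      then show "\<omega> \<in> {\<omega> \<in> space M. x' / d < X \<omega> \<and> T \<omega> \<in> {a<..d}}" using * by simp
    qed measurable
    also have "\<dots> \<le> (1 + \<eta>) * J (x / a) {a<..d} * F (x' / d) / F (x / a)"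
      using y0[OF yd ya, of "{a<..d}"] F_pos[of "x / a"] by (simp add: pos_le_divide_eq)
    also have "\<dots> \<le> (1 + \<eta>) * J (x / a) {a<..d} * ((1 + \<eta>) * F (x / a)) / F (x / a)"
      using ratio[OF ad] F_pos[of "x / a"] \<eta>
      by (intro divide_right_mono mult_left_mono) (auto simp: J_def)
    also have "\<dots> = (1 + \<eta>)\<^sup>2 * J (x / a) {a<..d}"
      using F_pos[of "x / a"] by (simp add: power2_eq_square)
    also have "J (x / a) {a<..d} \<le> Q x {a<..d}"
      unfolding Q_def J_def
    proof (intro finite_measure_mono subsetI)
      fix \<omega> assume "\<omega> \<in> {\<omega> \<in> space M. x / a < X \<omega> \<and> T \<omega> \<in> {a<..d}}"
      then have *: "\<omega> \<in> space M" "x / a < X \<omega>" "a < T \<omega>" "T \<omega> \<le> d" by auto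
      have "x < a * X \<omega>" using *(2) a by (simp add: pos_divide_less_eq mult.commute)
      moreover have "X \<omega> > 0" using *(2) a x by (meson divide_pos_pos less_trans)
      then have "a * X \<omega> \<le> T \<omega> * X \<omega>" using *(3) by (intro mult_right_mono) auto
      ultimately show "\<omega> \<in> {\<omega> \<in> space M. x < T \<omega> * X \<omega> \<and> T \<omega> \<in> {a<..d}}" using * by simp
    qed measurable
    finally show ?thesis by (simp add: mult_left_mono)
  qed
  have ind: "Q x' {\<epsilon><..v k} \<le> (1 + \<eta>)\<^sup>2 * Q x {\<epsilon><..v k}" for k
  proof (induction k)
    case 0
    have "{\<epsilon><..v 0} = {}" by (auto simp: v_def)
    then show ?case by (simp add: Q_def)
  next
    case (Suc k)
    have mono: "v k \<le> v (Suc k)" and step: "v (Suc k) \<le> v k + w"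
      using w by (auto simp: v_def min_def algebra_simps)
    show ?case
    proof (cases "\<epsilon> \<le> v k")
      case True
      have split: "Q z {\<epsilon><..v (Suc k)} = Q z {\<epsilon><..v k} + Q z {v k<..v (Suc k)}" for z
        unfolding Q_def using True mono
        by (subst finite_measure_Union[symmetric]) (auto intro!: arg_cong[where f=prob])
      have "Q x' {v k<..v (Suc k)} \<le> (1 + \<eta>)\<^sup>2 * Q x {v k<..v (Suc k)}"
        by (rule piece[OF True mono step]) (simp add: v_def)
      then show ?thesis using Suc.IH by (simp add: split algebra_simps)
    next
      case False
      then have "B < \<epsilon>" using w by (auto simp: v_def min_def split: if_splits)
      then have "{\<epsilon><..v (Suc k)} = {}" by (auto simp: v_def)
      then show ?thesis by (simp add: Q_def)
    qed
  qed
  obtain N where N: "B < real N * w" using ex_less_of_nat_mult[OF w] by blast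
  then have vN: "v N = B" using \<epsilon> by (simp add: v_def)
  have "\<P>(\<omega> in M. T \<omega> * X \<omega> > x' \<and> T \<omega> > \<epsilon>) \<le> Q x' {\<epsilon><..B}"
    unfolding Q_def
  proof (rule finite_measure_mono_AE)
    show "AE \<omega> in M. \<omega> \<in> {\<omega> \<in> space M. x' < T \<omega> * X \<omega> \<and> \<epsilon> < T \<omega>} \<longrightarrow>
        \<omega> \<in> {\<omega> \<in> space M. x' < T \<omega> * X \<omega> \<and> T \<omega> \<in> {\<epsilon><..B}}"
      using T_bounds by eventually_elim simp
  qed measurable
  also have "\<dots> \<le> (1 + \<eta>)\<^sup>2 * Q x {\<epsilon><..B}" using ind[of N] by (simp add: vN)
  also have "Q x {\<epsilon><..B} \<le> H x"
    unfolding Q_def H_def by (intro finite_measure_mono) auto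
  finally show ?thesis by (simp add: mult_left_mono)
qed

text \<open>
  Small and large weights together. The mesh \<open>w\<close> of the partition may depend on \<open>x\<close>.
\<close>

lemma weighted_tail_ratio:
  assumes \<eta>: "\<eta> > 0" and half: "\<forall>\<^sub>F x in at_top. s x \<ge> x / 2"
    and ratio: "\<And>\<epsilon>. \<epsilon> > 0 \<Longrightarrow> \<forall>\<^sub>F x in at_top. \<exists>w>0. \<forall>u v.
      \<epsilon> \<le> u \<longrightarrow> u \<le> v \<longrightarrow> v \<le> u + w \<longrightarrow> v \<le> B \<longrightarrow> F (s x / v) \<le> (1 + \<eta>) * F (x / u)"
  shows "\<forall>\<^sub>F x in at_top. H (s x) \<le> ((1 + \<eta>)\<^sup>2 + \<eta>) * H x"
proof -
  obtain \<epsilon> where \<epsilon>: "\<epsilon> > 0"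
    and small: "\<forall>\<^sub>F x in at_top. \<forall>x'\<ge>x / 2. \<P>(\<omega> in M. T \<omega> * X \<omega> > x' \<and> T \<omega> \<le> \<epsilon>) \<le> \<eta> * H x"
    using small_weights[OF \<eta>] by blast
  obtain y0 where y0: "\<And>y y' I. y \<ge> y0 \<Longrightarrow> y' \<ge> y0 \<Longrightarrow> I \<in> sets borel \<Longrightarrow>
      J y I * F y' \<le> (1 + \<eta>) * J y' I * F y"
    using J_comparison[OF \<eta>] by blast
  show ?thesis
    using small half ratio[OF \<epsilon>] eventually_gt_at_top[of 0] eventually_ge_at_top[of "2 * B * \<bar>y0\<bar>"]
  proof eventually_elim
    case (elim x)
    obtain w where w: "w > 0" and rat: "\<And>u v. \<epsilon> \<le> u \<Longrightarrow> u \<le> v \<Longrightarrow> v \<le> u + w \<Longrightarrow> v \<le> B \<Longrightarrow>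
        F (s x / v) \<le> (1 + \<eta>) * F (x / u)"
      using elim(3) by blast
    have sx: "s x > 0" using elim(2,4) by simp
    have "B * y0 \<le> B * \<bar>y0\<bar>" using B_pos by (intro mult_left_mono) auto
    moreover have "B * \<bar>y0\<bar> \<ge> 0" using B_pos by simp
    ultimately have "B * y0 \<le> x" "B * y0 \<le> s x" using elim(2,5) by linarith+
    then have large: "y0 \<le> x / B" "y0 \<le> s x / B"
      using B_pos by (simp_all add: pos_le_divide_eq mult.commute)
    have "H (s x) = \<P>(\<omega> in M. T \<omega> * X \<omega> > s x \<and> T \<omega> > \<epsilon>) + \<P>(\<omega> in M. T \<omega> * X \<omega> > s x \<and> T \<omega> \<le> \<epsilon>)"
      unfolding H_def
      by (subst finite_measure_Union[symmetric]) (auto intro!: arg_cong[where f=prob])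
    also have "\<dots> \<le> (1 + \<eta>)\<^sup>2 * H x + \<eta> * H x"
    proof (rule add_mono)
      show "\<P>(\<omega> in M. T \<omega> * X \<omega> > s x \<and> T \<omega> > \<epsilon>) \<le> (1 + \<eta>)\<^sup>2 * H x"
        by (rule large_weights[OF \<eta> w \<epsilon> elim(4) sx y0 large rat])
      show "\<P>(\<omega> in M. T \<omega> * X \<omega> > s x \<and> T \<omega> \<le> \<epsilon>) \<le> \<eta> * H x"
        using elim(1,2) by blast
    qed
    finally show ?case by (simp add: algebra_simps)
  qed
qed

lemma weighted_tail_ratio':
  assumes \<eta>: "\<eta> > 0" and half: "\<forall>\<^sub>F x in at_top. s x \<ge> x / 2"
    and ratio: "\<And>\<epsilon>. \<epsilon> > 0 \<Longrightarrow> \<forall>\<^sub>F x in at_top. \<exists>w>0. \<forall>u v.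
      \<epsilon> \<le> u \<longrightarrow> u \<le> v \<longrightarrow> v \<le> u + w \<longrightarrow> v \<le> B \<longrightarrow> F (s x / v) \<le> (1 + min 1 \<eta> / 4) * F (x / u)"
  shows "\<forall>\<^sub>F x in at_top. H (s x) \<le> (1 + \<eta>) * H x"
proof -
  \<comment> \<open>For \<open>e \<le> 1\<close>, \<open>(1 + e)\<^sup>2 + e \<le> 1 + 4 * e\<close>.\<close>
  define e where "e = min 1 \<eta> / 4"
  have e: "e > 0" "e \<le> 1" "4 * e \<le> \<eta>" using \<eta> by (auto simp: e_def min_def)
  have "e * e \<le> 1 * e" using e by (intro mult_right_mono) auto
  moreover have "(1 + e)\<^sup>2 + e = 1 + 3 * e + e * e" by (simp add: power2_eq_square algebra_simps)
  ultimately have le: "(1 + e)\<^sup>2 + e \<le> 1 + \<eta>" using e by linarith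
  have "\<forall>\<^sub>F x in at_top. H (s x) \<le> ((1 + e)\<^sup>2 + e) * H x"
    using half ratio e(1) unfolding e_def[symmetric] by (intro weighted_tail_ratio) auto
  then show ?thesis
  proof eventually_elim
    case (elim x)
    have "((1 + e)\<^sup>2 + e) * H x \<le> (1 + \<eta>) * H x"
      using le by (intro mult_right_mono) (auto simp: H_def)
    with elim show ?case by linarith
  qed
qed

text \<open>
  With a mesh of order \<open>1 / x\<close>, the points \<open>(x - a) / v\<close> and \<open>x / u\<close> differ by a bounded amount for
  neighbouring weights \<open>u\<close>, \<open>v\<close> above \<open>\<epsilon>\<close>, and long-tailedness of \<open>X\<close> applies.
\<close>

lemma weighted_long_tailed:
  assumes long: "\<And>a. a > 0 \<Longrightarrow> ((\<lambda>x. F (x - a) / F x) \<longlongrightarrow> 1) at_top"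
    and a: "a > 0" and \<eta>: "\<eta> > 0"
  shows "\<forall>\<^sub>F x in at_top. H (x - a) \<le> (1 + \<eta>) * H x"
proof (rule weighted_tail_ratio'[OF \<eta>])
  show "\<forall>\<^sub>F x in at_top. x - a \<ge> x / 2"
    using eventually_ge_at_top[of "2 * a"] by eventually_elim simp
  define e where "e = min 1 \<eta> / 4"
  have e: "e > 0" using \<eta> by (simp add: e_def)
  fix \<epsilon> :: real assume \<epsilon>: "\<epsilon> > 0"
  define a' where "a' = 1 + a / \<epsilon>"
  have a': "a' > 0" using a \<epsilon> by (simp add: a'_def add_pos_pos)
  have "\<forall>\<^sub>F y in at_top. F (y - a') / F y < 1 + e"
    by (rule order_tendstoD(2)[OF long[OF a']]) (use e in simp)
  then obtain N where N: "\<And>y. y \<ge> N \<Longrightarrow> F (y - a') / F y < 1 + e"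
    unfolding eventually_at_top_linorder by blast
  show "\<forall>\<^sub>F x in at_top. \<exists>w>0. \<forall>u v. \<epsilon> \<le> u \<longrightarrow> u \<le> v \<longrightarrow> v \<le> u + w \<longrightarrow> v \<le> B \<longrightarrow>
      F ((x - a) / v) \<le> (1 + min 1 \<eta> / 4) * F (x / u)"
    using eventually_gt_at_top[of 0] eventually_ge_at_top[of "B * N"]
  proof eventually_elim
    case (elim x)
    show ?case
    proof (intro exI[of _ "\<epsilon>\<^sup>2 / x"] conjI allI impI)
      show "\<epsilon>\<^sup>2 / x > 0" using \<epsilon> elim by simp
      fix u v assume uv: "\<epsilon> \<le> u" "u \<le> v" "v \<le> u + \<epsilon>\<^sup>2 / x" "v \<le> B"
      have pos: "u > 0" "v > 0" using uv \<epsilon> by auto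
      have "x / u - x / v = x * (v - u) / (u * v)" using pos by (simp add: field_simps)
      also have "\<dots> \<le> \<epsilon>\<^sup>2 / (u * v)"
        using uv(3) elim pos by (intro divide_right_mono) (auto simp: field_simps)
      also have "\<dots> \<le> 1"
        using uv \<epsilon> pos by (simp add: power2_eq_square mult_mono)
      finally have "x / u - x / v \<le> 1" .
      moreover have "a / v \<le> a / \<epsilon>" using uv \<epsilon> a by (intro divide_left_mono) auto
      ultimately have "x / u - a' \<le> (x - a) / v" by (simp add: a'_def diff_divide_distrib)
      then have "F ((x - a) / v) \<le> F (x / u - a')" by (rule F_antimono)
      also have "F (x / u - a') \<le> (1 + e) * F (x / u)"
      proof -
        have "N \<le> x / B" using elim B_pos by (simp add: pos_le_divide_eq mult.commute)
        also have "x / B \<le> x / u" using uv pos elim by (intro divide_left_mono) auto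
        finally show ?thesis using N[of "x / u"] F_pos[of "x / u"] by (simp add: pos_divide_less_eq)
      qed
      finally show "F ((x - a) / v) \<le> (1 + min 1 \<eta> / 4) * F (x / u)" by (simp add: e_def)
    qed
  qed
qed

text \<open>
  Here a fixed mesh suffices. Half of the admissible rescaling \<open>r\<close> of \<open>X\<close> goes into the mesh and half
  into the rescaling \<open>s = (1 + r) / 2\<close> of the product, for which \<open>r \<le> s\<^sup>2\<close>.
\<close>

lemma weighted_consistently_varying:
  assumes cons: "\<And>\<eta>. \<eta> > 0 \<Longrightarrow> \<exists>v. 0 < v \<and> v < 1 \<and> (\<forall>\<^sub>F x in at_top. F (v * x) \<le> (1 + \<eta>) * F x)"
    and \<eta>: "\<eta> > 0"
  shows "\<exists>v. 0 < v \<and> v < 1 \<and> (\<forall>\<^sub>F x in at_top. H (v * x) \<le> (1 + \<eta>) * H x)"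
proof -
  have "min 1 \<eta> / 4 > 0" using \<eta> by simp
  then obtain r where r: "0 < r" "r < 1"
    and ev: "\<forall>\<^sub>F x in at_top. F (r * x) \<le> (1 + min 1 \<eta> / 4) * F x"
    using cons by blast
  obtain N where N: "\<And>y. y \<ge> N \<Longrightarrow> F (r * y) \<le> (1 + min 1 \<eta> / 4) * F y"
    using ev unfolding eventually_at_top_linorder by blast
  define s where "s = (1 + r) / 2"
  have s: "0 < s" "s < 1" "s \<ge> 1 / 2" using r by (auto simp: s_def)
  have "0 \<le> ((1 - r) / 2)\<^sup>2" by simp
  then have s2: "r \<le> s * s" by (simp add: s_def power2_eq_square field_simps)
  have "\<forall>\<^sub>F x in at_top. H (s * x) \<le> (1 + \<eta>) * H x"
  proof (rule weighted_tail_ratio'[OF \<eta>])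
    show "\<forall>\<^sub>F x in at_top. s * x \<ge> x / 2"
      using eventually_ge_at_top[of 0] by eventually_elim (use s mult_right_mono[of "1/2" s] in auto)
    fix \<epsilon> :: real assume \<epsilon>: "\<epsilon> > 0"
    show "\<forall>\<^sub>F x in at_top. \<exists>w>0. \<forall>u v. \<epsilon> \<le> u \<longrightarrow> u \<le> v \<longrightarrow> v \<le> u + w \<longrightarrow> v \<le> B \<longrightarrow>
        F (s * x / v) \<le> (1 + min 1 \<eta> / 4) * F (x / u)"
      using eventually_gt_at_top[of 0] eventually_ge_at_top[of "B * N"]
    proof eventually_elim
      case (elim x)
      show ?case
      proof (intro exI[of _ "\<epsilon> * (1 - s)"] conjI allI impI)
        show "\<epsilon> * (1 - s) > 0" using \<epsilon> s by simp
        fix u v assume uv: "\<epsilon> \<le> u" "u \<le> v" "v \<le> u + \<epsilon> * (1 - s)" "v \<le> B"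
        have pos: "u > 0" "v > 0" using uv \<epsilon> by auto
        have "\<epsilon> * (1 - s) \<le> u * (1 - s)" using uv s by (intro mult_right_mono) auto
        then have "v \<le> u * (2 - s)" using uv(3) by (simp add: algebra_simps)
        then have "s * v \<le> s * (u * (2 - s))" using s by (intro mult_left_mono) auto
        also have "\<dots> = u * (1 - (1 - s)\<^sup>2)" by (simp add: power2_eq_square algebra_simps)
        also have "\<dots> \<le> u * 1" using pos by (intro mult_left_mono) auto
        finally have sv: "s * v \<le> u" by simp
        have "r * v \<le> s * s * v" using s2 pos by (intro mult_right_mono) auto
        also have "\<dots> \<le> s * u" using mult_left_mono[OF sv, of s] s by (simp add: mult.assoc)
        finally have "x * (r * v) \<le> x * (s * u)" using elim by (intro mult_left_mono) auto
        then have "r * (x / u) \<le> s * x / v" using pos by (simp add: field_simps)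
        then have "F (s * x / v) \<le> F (r * (x / u))" by (rule F_antimono)
        moreover have "N \<le> x / u"
        proof -
          have "N \<le> x / B" using elim B_pos by (simp add: pos_le_divide_eq mult.commute)
          also have "x / B \<le> x / u" using uv pos elim by (intro divide_left_mono) auto
          finally show ?thesis .
        qed
        ultimately show "F (s * x / v) \<le> (1 + min 1 \<eta> / 4) * F (x / u)"
          using N[of "x / u"] by linarith
      qed
    qed
  qed
  then show ?thesis using s by blast
qed

end

section \<open>One big jump\<close>

context prob_space begin

lemma tail_distr:
  fixes X :: "'a \<Rightarrow> real"
  assumes [measurable]: "random_variable borel X"
  shows "tail (distr M borel X) x = \<P>(\<omega> in M. X \<omega> > x)"
proof -
  have "\<P>(\<omega> in M. X \<omega> > x) = prob (space M - {\<omega> \<in> space M. X \<omega> \<le> x})"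
    by (intro arg_cong[where f=prob]) auto
  also have "\<dots> = 1 - \<P>(\<omega> in M. X \<omega> \<le> x)" by (intro prob_compl) measurable
  also have "\<P>(\<omega> in M. X \<omega> \<le> x) = cdf (distr M borel X) x"
    unfolding cdf_def by (subst measure_distr) (auto intro!: arg_cong[where f=prob])
  finally show ?thesis by (simp add: tail_def)
qed

text \<open>
  The weight is essentially bounded: for a fixed large \<open>x\<close>, the probability of \<open>T > b x\<close> is at most
  that of \<open>Y > y\<close> for every large \<open>y\<close>, hence zero.
\<close>

lemma AE_bounded_if_small:
  fixes X Y T :: "'a \<Rightarrow> real" and b :: "real \<Rightarrow> real"
  assumes T: "random_variable borel T" and X: "random_variable borel X" and Y: "random_variable borel Y"
    and small: "(\<lambda>(x, y). \<P>(\<omega> in M. T \<omega> > b x))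
      \<in> o[at_top \<times>\<^sub>F at_top](\<lambda>(x, y). \<P>(\<omega> in M. X \<omega> > x \<and> Y \<omega> > y))"
  shows "\<exists>B. AE \<omega> in M. T \<omega> \<le> B"
proof -
  note [measurable] = T X Y
  have "\<forall>\<^sub>F z in at_top \<times>\<^sub>F at_top. norm (case z of (x, y) \<Rightarrow> \<P>(\<omega> in M. T \<omega> > b x))
      \<le> 1 * norm (case z of (x, y) \<Rightarrow> \<P>(\<omega> in M. X \<omega> > x \<and> Y \<omega> > y))"
    using small by (rule landau_o.smallD) simp
  then obtain P Q :: "real \<Rightarrow> bool" where P: "eventually P at_top" and Q: "eventually Q at_top"
    and PQ: "\<And>x y. P x \<Longrightarrow> Q y \<Longrightarrow> \<P>(\<omega> in M. T \<omega> > b x) \<le> \<P>(\<omega> in M. X \<omega> > x \<and> Y \<omega> > y)"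
    unfolding eventually_prod_filter by (auto simp: measure_nonneg)
  obtain x where x: "P x" using P eventually_happens'[OF trivial_limit_at_top_linorder] by blast
  interpret Y: real_distribution "distr M borel Y" using Y by simp
  have "((\<lambda>y. 1 - cdf (distr M borel Y) y) \<longlongrightarrow> 1 - 1) at_top"
    by (intro tendsto_intros Y.cdf_lim_at_top_prob)
  then have lim: "((\<lambda>y. \<P>(\<omega> in M. Y \<omega> > y)) \<longlongrightarrow> 0) at_top"
    using tail_distr[OF Y] by (simp add: tail_def)
  have "\<P>(\<omega> in M. T \<omega> > b x) \<le> 0"
  proof (rule tendsto_lowerbound[OF lim])
    show "\<forall>\<^sub>F y in at_top. \<P>(\<omega> in M. T \<omega> > b x) \<le> \<P>(\<omega> in M. Y \<omega> > y)"
      using Q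
    proof eventually_elim
      case (elim y)
      have "\<P>(\<omega> in M. X \<omega> > x \<and> Y \<omega> > y) \<le> \<P>(\<omega> in M. Y \<omega> > y)"
        by (intro finite_measure_mono) auto
      then show ?case using PQ[OF x elim] by simp
    qed
  qed simp
  then have "\<P>(\<omega> in M. T \<omega> > b x) = 0" by (simp add: order_antisym measure_nonneg)
  then have "AE \<omega> in M. \<not> T \<omega> > b x" by (subst (asm) prob_eq_0) auto
  then show ?thesis by (intro exI[of _ "b x"]) (simp add: not_less)
qed

lemma joint_tail_bounded_weights:
  fixes X X' T T' :: "'a \<Rightarrow> real" and B u v :: real
  assumes [measurable]: "random_variable borel X" "random_variable borel X'"
      "random_variable borel T" "random_variable borel T'"
    and T: "AE \<omega> in M. 0 \<le> T \<omega> \<and> T \<omega> \<le> B" and T': "AE \<omega> in M. 0 \<le> T' \<omega> \<and> T' \<omega> \<le> B"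
    and B: "B > 0" and uv: "u \<ge> 0" "v \<ge> 0"
  shows "\<P>(\<omega> in M. \<bar>T \<omega> * X \<omega>\<bar> > u \<and> T' \<omega> * X' \<omega> > v) \<le>
    \<P>(\<omega> in M. \<bar>X \<omega>\<bar> > u / B \<and> X' \<omega> > v / B)"
proof (rule finite_measure_mono_AE)
  have bound: "z / B < x" if "0 \<le> t" "t \<le> B" "0 \<le> z" "z < t * x" for t x z :: real
  proof -
    have "x > 0" using that by (smt (verit) mult_nonneg_nonpos)
    then have "t * x \<le> B * x" using that by (intro mult_right_mono) auto
    then show ?thesis using that B by (simp add: pos_divide_less_eq mult.commute)
  qed
  show "AE \<omega> in M. \<omega> \<in> {\<omega> \<in> space M. u < \<bar>T \<omega> * X \<omega>\<bar> \<and> v < T' \<omega> * X' \<omega>} \<longrightarrow>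
      \<omega> \<in> {\<omega> \<in> space M. u / B < \<bar>X \<omega>\<bar> \<and> v / B < X' \<omega>}"
    using T T'
  proof eventually_elim
    case (elim \<omega>)
    have "u < \<bar>T \<omega> * X \<omega>\<bar> \<longrightarrow> u / B < \<bar>X \<omega>\<bar>"
      using bound[of "T \<omega>" u "\<bar>X \<omega>\<bar>"] elim uv by (simp add: abs_mult)
    moreover have "v < T' \<omega> * X' \<omega> \<longrightarrow> v / B < X' \<omega>"
      using bound[of "T' \<omega>" v "X' \<omega>"] elim uv by simp
    ultimately show ?case by simp
  qed
qed measurable

text \<open>
  The principle of a single big jump, for any \<open>Z\<close> that is at most the sum of the positive parts of
  the \<open>Y i\<close> and exceeds \<open>x\<close> whenever one \<open>Y j\<close> exceeds \<open>x + l\<close> and all others are at most \<open>l / n\<close> in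
  absolute value. The slack \<open>l x\<close> has to be small enough not to change the tails much, and large
  enough for two variables to be rarely large together.

  If \<open>Z > x\<close>, then some \<open>Y i > x - l\<close>, or else some \<open>Y j > x / n\<close> and, the remaining terms having sum
  above \<open>l\<close>, some other \<open>Y i > l / n\<close>. Conversely, the events that \<open>Y j > x + l\<close> and all others are
  at most \<open>l / n\<close> in absolute value are disjoint and contained in \<open>Z > x\<close>.
\<close>

lemma one_big_jump:
  fixes Y :: "nat \<Rightarrow> 'a \<Rightarrow> real" and Z :: "'a \<Rightarrow> real" and n :: nat
  defines "H \<equiv> \<lambda>i x. \<P>(\<omega> in M. Y i \<omega> > x)"
  defines "S \<equiv> \<lambda>x. \<Sum>i=1..n. H i x"
  assumes n: "n \<ge> 1"
    and Y: "\<And>i. i \<in> {1..n} \<Longrightarrow> random_variable borel (Y i)"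
    and Z: "random_variable borel Z"
    and pos: "\<forall>\<^sub>F x in at_top. S x > 0"
    and key: "\<And>\<epsilon>. \<epsilon> > 0 \<Longrightarrow> \<exists>l. \<forall>\<^sub>F x in at_top. l x > 0 \<and>
      (\<forall>i\<in>{1..n}. H i (x - l x) \<le> (1 + \<epsilon>) * H i x \<and> H i x \<le> (1 + \<epsilon>) * H i (x + l x)) \<and>
      (\<forall>i\<in>{1..n}. \<forall>j\<in>{1..n}. i \<noteq> j \<longrightarrow>
        \<P>(\<omega> in M. \<bar>Y i \<omega>\<bar> > l x / n \<and> Y j \<omega> > x / n) \<le> \<epsilon> * S x)"
    and Z_le: "\<And>\<omega>. \<omega> \<in> space M \<Longrightarrow> Z \<omega> \<le> (\<Sum>i=1..n. max (Y i \<omega>) 0)"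
    and Z_gt: "\<And>\<omega> j x l. \<omega> \<in> space M \<Longrightarrow> l > 0 \<Longrightarrow> j \<in> {1..n} \<Longrightarrow> Y j \<omega> > x + l \<Longrightarrow>
      (\<And>i. i \<in> {1..n} - {j} \<Longrightarrow> \<bar>Y i \<omega>\<bar> \<le> l / n) \<Longrightarrow> Z \<omega> > x"
  shows "(\<lambda>x. \<P>(\<omega> in M. Z \<omega> > x)) \<sim>[at_top] S"
proof (rule asymp_equivI', rule tendstoI)
  fix e :: real assume e: "e > 0"
  define I where "I = {1..n}"
  have I: "finite I" "card I = n" by (auto simp: I_def)
  have [measurable]: "random_variable borel (Y i)" if "i \<in> I" for i using that Y by (simp add: I_def)
  note [measurable] = Z
  \<comment> \<open>Below, \<open>\<epsilon>\<close> is lost once by shifting the tails and at most \<open>n\<^sup>2\<close> times by pairs of large variables.\<close>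
  define \<epsilon> where "\<epsilon> = e / (2 * (1 + real n * real n))"
  have n2: "1 + real n * real n > 0" by (simp add: add_pos_nonneg)
  have \<epsilon>: "\<epsilon> > 0" using e n2 by (simp add: \<epsilon>_def)
  have "q * (e / (2 * q)) = e / 2" if "q > 0" for q :: real using that by simp
  from this[OF n2] have "(1 + real n * real n) * \<epsilon> = e / 2" unfolding \<epsilon>_def .
  then have \<epsilon>e: "(1 + real n * real n) * \<epsilon> < e" using e by simp
  obtain l where l: "\<forall>\<^sub>F x in at_top. l x > 0 \<and>
      (\<forall>i\<in>I. H i (x - l x) \<le> (1 + \<epsilon>) * H i x \<and> H i x \<le> (1 + \<epsilon>) * H i (x + l x)) \<and>
      (\<forall>i\<in>I. \<forall>j\<in>I. i \<noteq> j \<longrightarrow>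
        \<P>(\<omega> in M. \<bar>Y i \<omega>\<bar> > l x / n \<and> Y j \<omega> > x / n) \<le> \<epsilon> * S x)"
    using key[OF \<epsilon>] unfolding I_def by blast
  show "\<forall>\<^sub>F x in at_top. dist (\<P>(\<omega> in M. Z \<omega> > x) / S x) 1 < e"
    using l pos eventually_gt_at_top[of 0]
  proof eventually_elim
    case (elim x)
    define d where "d = l x"
    have d: "d > 0" using elim by (simp add: d_def)
    have x: "x > 0" using elim by simp
    have shift: "H i (x - d) \<le> (1 + \<epsilon>) * H i x" "H i x \<le> (1 + \<epsilon>) * H i (x + d)" if "i \<in> I" for i
      using elim that by (auto simp: d_def)
    define J where "J i j = {\<omega>\<in>space M. \<bar>Y i \<omega>\<bar> > d / n \<and> Y j \<omega> > x / n}" for i j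
    have J_meas [measurable]: "J i j \<in> events" if "i \<in> I" "j \<in> I" for i j
      using that unfolding J_def by measurable
    have J: "prob (J i j) \<le> \<epsilon> * S x" if "i \<in> I" "j \<in> I" "i \<noteq> j" for i j
      using elim that by (auto simp: d_def J_def)
    have Spos: "S x > 0" using elim by simp
    have n1: "real n \<ge> 1" using n by simp
    have Jsum: "(\<Sum>j\<in>I. \<Sum>i\<in>I - {j}. prob (J i j)) \<le> real n * real n * (\<epsilon> * S x)"
    proof -
      have "(\<Sum>j\<in>I. \<Sum>i\<in>I - {j}. prob (J i j)) \<le> (\<Sum>j\<in>I. \<Sum>i\<in>I - {j}. \<epsilon> * S x)"
        using J by (intro sum_mono) auto
      also have "\<dots> \<le> (\<Sum>j\<in>I. \<Sum>i\<in>I. \<epsilon> * S x)"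
        using I \<epsilon> Spos by (intro sum_mono sum_mono2) auto
      also have "\<dots> = real n * real n * (\<epsilon> * S x)" using I by simp
      finally show ?thesis .
    qed
    have upper: "\<P>(\<omega> in M. Z \<omega> > x) \<le> (1 + (1 + real n * real n) * \<epsilon>) * S x"
    proof -
      have sub: "{\<omega>\<in>space M. Z \<omega> > x} \<subseteq>
          (\<Union>i\<in>I. {\<omega>\<in>space M. Y i \<omega> > x - d}) \<union> (\<Union>j\<in>I. \<Union>i\<in>I - {j}. J i j)"
      proof
        fix \<omega> assume "\<omega> \<in> {\<omega>\<in>space M. Z \<omega> > x}"
        then have w: "\<omega> \<in> space M" and "x < (\<Sum>i\<in>I. max (Y i \<omega>) 0)"
          using Z_le[of \<omega>] by (auto simp: I_def)
        show "\<omega> \<in> (\<Union>i\<in>I. {\<omega>\<in>space M. Y i \<omega> > x - d}) \<union> (\<Union>j\<in>I. \<Union>i\<in>I - {j}. J i j)"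
        proof (rule ccontr)
          assume no: "\<omega> \<notin> (\<Union>i\<in>I. {\<omega>\<in>space M. Y i \<omega> > x - d}) \<union> (\<Union>j\<in>I. \<Union>i\<in>I - {j}. J i j)"
          have "\<exists>j\<in>I. Y j \<omega> > x / n"
          proof (rule ccontr)
            assume "\<not> (\<exists>j\<in>I. Y j \<omega> > x / n)"
            then have "(\<Sum>i\<in>I. max (Y i \<omega>) 0) \<le> (\<Sum>i\<in>I. x / n)"
              using x by (intro sum_mono) (auto simp: not_less)
            then show False using \<open>x < _\<close> I n1 by simp
          qed
          then obtain j where j: "j \<in> I" "Y j \<omega> > x / n" by blast
          have Yj: "Y j \<omega> \<le> x - d" using no j w by (auto simp: not_less)
          have Yj0: "Y j \<omega> \<ge> 0" using j x n1 by (smt (verit) divide_nonneg_nonneg)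
          have "Y i \<omega> \<le> d / n" if "i \<in> I - {j}" for i
          proof -
            have "\<omega> \<notin> J i j" using no j(1) that by blast
            then show ?thesis using w j(2) by (auto simp: J_def)
          qed
          then have "(\<Sum>i\<in>I - {j}. max (Y i \<omega>) 0) \<le> (\<Sum>i\<in>I - {j}. d / n)"
            using d by (intro sum_mono) auto
          also have "\<dots> \<le> (\<Sum>i\<in>I. d / n)" using I d by (intro sum_mono2) auto
          also have "\<dots> = d" using I n1 by simp
          finally have "(\<Sum>i\<in>I. max (Y i \<omega>) 0) \<le> x"
            using Yj Yj0 I j by (subst sum.remove[of _ j]) auto
          then show False using \<open>x < _\<close> by simp
        qed
      qed
      have "\<P>(\<omega> in M. Z \<omega> > x) \<le>
          prob ((\<Union>i\<in>I. {\<omega>\<in>space M. Y i \<omega> > x - d}) \<union> (\<Union>j\<in>I. \<Union>i\<in>I - {j}. J i j))"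
        using sub I by (intro finite_measure_mono sets.Un sets.finite_UN J_meas) auto
      also have "\<dots> \<le> prob (\<Union>i\<in>I. {\<omega>\<in>space M. Y i \<omega> > x - d}) + prob (\<Union>j\<in>I. \<Union>i\<in>I - {j}. J i j)"
        using I by (intro measure_Un_le sets.finite_UN J_meas) auto
      also have "prob (\<Union>i\<in>I. {\<omega>\<in>space M. Y i \<omega> > x - d}) \<le> (\<Sum>i\<in>I. H i (x - d))"
        unfolding H_def using I by (intro measure_UNION_le) auto
      also have "\<dots> \<le> (\<Sum>i\<in>I. (1 + \<epsilon>) * H i x)" using shift by (intro sum_mono) auto
      also have "\<dots> = (1 + \<epsilon>) * S x" by (simp add: S_def I_def sum_distrib_left)
      also have "prob (\<Union>j\<in>I. \<Union>i\<in>I - {j}. J i j) \<le> (\<Sum>j\<in>I. prob (\<Union>i\<in>I - {j}. J i j))"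
        using I by (intro measure_UNION_le sets.finite_UN J_meas) auto
      also have "\<dots> \<le> (\<Sum>j\<in>I. \<Sum>i\<in>I - {j}. prob (J i j))"
        using I by (intro sum_mono measure_UNION_le J_meas) auto
      also note Jsum
      finally show ?thesis by (simp add: algebra_simps)
    qed
    have lower: "(1 - (1 + real n * real n) * \<epsilon>) * S x \<le> \<P>(\<omega> in M. Z \<omega> > x)"
    proof -
      define E where "E j = {\<omega>\<in>space M. Y j \<omega> > x + d \<and> (\<forall>i\<in>I - {j}. \<bar>Y i \<omega>\<bar> \<le> d / n)}" for j
      have E_meas: "E j \<in> events" if "j \<in> I" for j
        using that I unfolding E_def by measurable
      have dn: "d / n \<le> d" using d n1 by (simp add: field_simps)
      have disj: "disjoint_family_on E I"
        unfolding disjoint_family_on_def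
      proof (intro ballI impI)
        fix j k assume jk: "j \<in> I" "k \<in> I" "j \<noteq> k"
        have False if "\<omega> \<in> E j" "\<omega> \<in> E k" for \<omega>
        proof -
          have "Y j \<omega> > x + d" "\<bar>Y j \<omega>\<bar> \<le> d / n" using that jk by (auto simp: E_def)
          then show False using dn x by linarith
        qed
        then show "E j \<inter> E k = {}" by blast
      qed
      have "(1 - \<epsilon>) * S x \<le> (\<Sum>j\<in>I. H j (x + d))"
      proof -
        have "(1 - \<epsilon>) * H j x \<le> H j (x + d)" if "j \<in> I" for j
        proof (cases "\<epsilon> \<le> 1")
          case True
          have "(1 - \<epsilon>) * H j x \<le> (1 - \<epsilon>) * ((1 + \<epsilon>) * H j (x + d))"
            using shift(2)[OF that] True by (intro mult_left_mono) auto
          also have "\<dots> = (1 - \<epsilon> * \<epsilon>) * H j (x + d)" by (simp add: algebra_simps)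
          also have "\<dots> \<le> 1 * H j (x + d)"
            using \<epsilon> by (intro mult_right_mono) (auto simp: H_def)
          finally show ?thesis by simp
        next
          case False
          then have "(1 - \<epsilon>) * H j x \<le> 0" by (intro mult_nonpos_nonneg) (auto simp: H_def)
          then show ?thesis by (smt (verit) H_def measure_nonneg)
        qed
        then have "(\<Sum>j\<in>I. (1 - \<epsilon>) * H j x) \<le> (\<Sum>j\<in>I. H j (x + d))" by (intro sum_mono) auto
        then show ?thesis by (simp add: S_def I_def sum_distrib_left)
      qed
      also have "\<dots> \<le> (\<Sum>j\<in>I. prob (E j) + (\<Sum>i\<in>I - {j}. prob (J i j)))"
      proof (rule sum_mono)
        fix j assume j: "j \<in> I"
        have xn: "x / n \<le> x + d"
        proof -
          have "x / n \<le> x" using x n1 by (simp add: field_simps)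
          then show ?thesis using d by simp
        qed
        have "H j (x + d) \<le> prob (E j \<union> (\<Union>i\<in>I - {j}. J i j))"
          unfolding H_def
        proof (rule finite_measure_mono)
          show "{\<omega> \<in> space M. x + d < Y j \<omega>} \<subseteq> E j \<union> (\<Union>i\<in>I - {j}. J i j)"
            using xn by (fastforce simp: E_def J_def not_le)
          show "E j \<union> (\<Union>i\<in>I - {j}. J i j) \<in> events"
            using I j by (intro sets.Un sets.finite_UN E_meas J_meas) auto
        qed
        also have "\<dots> \<le> prob (E j) + prob (\<Union>i\<in>I - {j}. J i j)"
          using I j by (intro measure_Un_le sets.finite_UN E_meas J_meas) auto
        also have "prob (\<Union>i\<in>I - {j}. J i j) \<le> (\<Sum>i\<in>I - {j}. prob (J i j))"
          using I j by (intro measure_UNION_le J_meas) auto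
        finally show "H j (x + d) \<le> prob (E j) + (\<Sum>i\<in>I - {j}. prob (J i j))" by simp
      qed
      also have "\<dots> = (\<Sum>j\<in>I. prob (E j)) + (\<Sum>j\<in>I. \<Sum>i\<in>I - {j}. prob (J i j))"
        by (rule sum.distrib)
      also have "(\<Sum>j\<in>I. prob (E j)) = prob (\<Union>j\<in>I. E j)"
        using I E_meas disj by (intro finite_measure_finite_Union[symmetric]) auto
      also have "\<dots> \<le> \<P>(\<omega> in M. Z \<omega> > x)"
      proof (rule finite_measure_mono)
        show "(\<Union>j\<in>I. E j) \<subseteq> {\<omega>\<in>space M. Z \<omega> > x}"
          using Z_gt[OF _ d] unfolding E_def I_def by blast
      qed measurable
      also note Jsum
      finally show ?thesis by (simp add: algebra_simps)
    qed
    define p where "p = \<P>(\<omega> in M. Z \<omega> > x)"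
    have "(1 + real n * real n) * \<epsilon> * S x < e * S x"
      using \<epsilon>e Spos by (rule mult_strict_right_mono)
    then have "p < (1 + e) * S x" "(1 - e) * S x < p"
      using upper lower unfolding p_def[symmetric] by (simp_all add: algebra_simps)
    then have "p / S x < 1 + e" "1 - e < p / S x"
      using Spos by (simp_all add: pos_divide_less_eq pos_less_divide_eq)
    then show "dist (\<P>(\<omega> in M. Z \<omega> > x) / S x) 1 < e"
      by (simp add: p_def dist_real_def abs_less_iff)
  qed
qed

end

section \<open>Asymptotic independence of the products\<close>

text \<open>
  For a non-increasing function, a scaling factor that costs at most \<open>c\<close> may be moved closer to 1.
  In this form finitely many functions share a common factor.
\<close>

lemma eventually_at_left_1_tail:
  fixes H :: "real \<Rightarrow> real"
  assumes anti: "\<And>x y. x \<le> y \<Longrightarrow> H y \<le> H x"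
    and v: "0 < v" "v < 1" and ev: "\<forall>\<^sub>F x in at_top. H (v * x) \<le> c * H x"
  shows "\<forall>\<^sub>F w in at_left 1. \<forall>\<^sub>F x in at_top. H (w * x) \<le> c * H x"
  unfolding eventually_at_left_field
proof (intro exI[of _ v] conjI allI impI v(2))
  fix w assume w: "v < w" "w < 1"
  show "\<forall>\<^sub>F x in at_top. H (w * x) \<le> c * H x"
    using ev eventually_ge_at_top[of 0]
  proof eventually_elim
    case (elim x)
    have "H (w * x) \<le> H (v * x)" using w elim by (intro anti mult_right_mono) auto
    then show ?case using elim by linarith
  qed
qed

context prob_space begin

text \<open>
  With weights bounded by \<open>B\<close>, large products force large \<open>X i\<close> and \<open>X j\<close>, and the tail of \<open>X j\<close> at
  \<open>x / (n * B)\<close> is at most a constant times the tail of \<open>\<Theta> j * X j\<close> at \<open>x\<close>. The same holds for the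
  quasi-asymptotic version below.
\<close>

lemma pTAI_weighted_joint_tail:
  fixes X :: "nat \<Rightarrow> 'a \<Rightarrow> real" and \<Theta> :: "nat \<Rightarrow> 'a \<Rightarrow> real"
  assumes pTAI: "pTAI M n X" and ij: "i \<in> {1..n}" "j \<in> {1..n}" "i \<noteq> j"
    and bi: "bounded_weight M (X i) (\<Theta> i) B" and bj: "bounded_weight M (X j) (\<Theta> j) B"
    and \<epsilon>: "\<epsilon> > 0"
  shows "\<forall>\<^sub>F l in at_top. \<forall>\<^sub>F x in at_top.
    \<P>(\<omega> in M. \<bar>\<Theta> i \<omega> * X i \<omega>\<bar> > l / n \<and> \<Theta> j \<omega> * X j \<omega> > x / n) \<le> \<epsilon> * \<P>(\<omega> in M. \<Theta> j \<omega> * X j \<omega> > x)"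
proof -
  interpret i: bounded_weight M "X i" "\<Theta> i" B by (fact bi)
  interpret j: bounded_weight M "X j" "\<Theta> j" B by (fact bj)
  define a where "a = 1 / (real n * B)"
  have n: "real n > 0" using ij by simp
  have a: "a > 0" using n j.B_pos by (simp add: a_def)
  have scale: "z / real n / B = a * z" for z by (simp add: a_def)
  have lim: "filterlim (\<lambda>x. a * x) at_top at_top"
    using a by (intro filterlim_tendsto_pos_mult_at_top[OF tendsto_const _ filterlim_ident])
  obtain C where C: "C > 0" "\<forall>\<^sub>F x in at_top. j.F (a * x) \<le> C * j.H x"
    using j.tail_le_weighted_tail[OF a] by blast
  have "\<forall>\<^sub>F z in at_top \<times>\<^sub>F at_top.
      (case z of (x, y) \<Rightarrow> \<P>(\<omega> in M. \<bar>X i \<omega>\<bar> > x \<bar> X j \<omega> > y)) < \<epsilon> / C"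
  proof (rule order_tendstoD(2))
    show "((\<lambda>(x, y). \<P>(\<omega> in M. \<bar>X i \<omega>\<bar> > x \<bar> X j \<omega> > y)) \<longlongrightarrow> 0) (at_top \<times>\<^sub>F at_top)"
      using pTAI ij unfolding pTAI_def by blast
  qed (use \<epsilon> C(1) in simp)
  then obtain P Q :: "real \<Rightarrow> bool" where P: "eventually P at_top" and Q: "eventually Q at_top"
    and PQ: "\<And>x y. P x \<Longrightarrow> Q y \<Longrightarrow> \<P>(\<omega> in M. \<bar>X i \<omega>\<bar> > x \<bar> X j \<omega> > y) < \<epsilon> / C"
    unfolding eventually_prod_filter by auto
  have joint: "\<P>(\<omega> in M. \<bar>X i \<omega>\<bar> > x \<and> X j \<omega> > y) \<le> \<epsilon> / C * j.F y" if "P x" "Q y" for x y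
    using PQ[OF that] j.F_pos[of y] by (simp add: cond_prob_def j.F_def pos_divide_less_eq)
  show ?thesis
    using eventually_compose_filterlim[OF P lim] eventually_ge_at_top[of 0]
  proof eventually_elim
    case (elim l)
    show ?case
      using eventually_compose_filterlim[OF Q lim] eventually_ge_at_top[of 0] C(2)
    proof eventually_elim
      fix x assume x: "Q (a * x)" "0 \<le> x" "j.F (a * x) \<le> C * j.H x"
      have "\<P>(\<omega> in M. \<bar>\<Theta> i \<omega> * X i \<omega>\<bar> > l / n \<and> \<Theta> j \<omega> * X j \<omega> > x / n)
          \<le> \<P>(\<omega> in M. \<bar>X i \<omega>\<bar> > l / n / B \<and> X j \<omega> > x / n / B)"
        using elim x n
        by (intro joint_tail_bounded_weights i.X_rv j.X_rv i.T_rv j.T_rv i.T_bounds j.T_bounds j.B_pos) auto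
      also have "\<dots> \<le> \<epsilon> / C * j.F (a * x)"
        unfolding scale using elim x by (intro joint) auto
      also have "\<dots> \<le> \<epsilon> / C * (C * j.H x)" using x \<epsilon> C by (intro mult_left_mono) auto
      also have "\<dots> = \<epsilon> * \<P>(\<omega> in M. \<Theta> j \<omega> * X j \<omega> > x)" using C by (simp add: j.H_def)
      finally show "\<P>(\<omega> in M. \<bar>\<Theta> i \<omega> * X i \<omega>\<bar> > l / n \<and> \<Theta> j \<omega> * X j \<omega> > x / n)
        \<le> \<epsilon> * \<P>(\<omega> in M. \<Theta> j \<omega> * X j \<omega> > x)" .
    qed
  qed
qed

lemma pQAI_weighted_joint_tail:
  fixes X :: "nat \<Rightarrow> 'a \<Rightarrow> real" and \<Theta> :: "nat \<Rightarrow> 'a \<Rightarrow> real"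
  assumes pQAI: "pQAI M n X" and ij: "i \<in> {1..n}" "j \<in> {1..n}" "i \<noteq> j"
    and bi: "bounded_weight M (X i) (\<Theta> i) B" and bj: "bounded_weight M (X j) (\<Theta> j) B"
    and \<epsilon>: "\<epsilon> > 0" and d: "0 < d" "d \<le> 1"
  shows "\<forall>\<^sub>F x in at_top.
    \<P>(\<omega> in M. \<bar>\<Theta> i \<omega> * X i \<omega>\<bar> > d * x / n \<and> \<Theta> j \<omega> * X j \<omega> > x / n) \<le>
    \<epsilon> * (\<P>(\<omega> in M. \<Theta> i \<omega> * X i \<omega> > x) + \<P>(\<omega> in M. \<Theta> j \<omega> * X j \<omega> > x))"
proof -
  interpret i: bounded_weight M "X i" "\<Theta> i" B by (fact bi)
  interpret j: bounded_weight M "X j" "\<Theta> j" B by (fact bj)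
  define a where "a = d / (real n * B)"
  have n: "real n > 0" using ij by simp
  have a: "a > 0" using n j.B_pos d by (simp add: a_def)
  have lim: "filterlim (\<lambda>x. a * x) at_top at_top"
    using a by (intro filterlim_tendsto_pos_mult_at_top[OF tendsto_const _ filterlim_ident])
  obtain Ci where Ci: "Ci > 0" "\<forall>\<^sub>F x in at_top. i.F (a * x) \<le> Ci * i.H x"
    using i.tail_le_weighted_tail[OF a] by blast
  obtain Cj where Cj: "Cj > 0" "\<forall>\<^sub>F x in at_top. j.F (a * x) \<le> Cj * j.H x"
    using j.tail_le_weighted_tail[OF a] by blast
  define \<delta> where "\<delta> = \<epsilon> / (2 * (Ci + Cj))"
  have \<delta>: "\<delta> > 0" using \<epsilon> Ci Cj by (simp add: \<delta>_def)
  have plus: "\<forall>\<^sub>F z in at_top. \<P>(\<omega> in M. max (X i \<omega>) 0 > z \<and> max (X j \<omega>) 0 > z) / (i.F z + j.F z) < \<delta>"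
    and minus: "\<forall>\<^sub>F z in at_top. \<P>(\<omega> in M. - min (X i \<omega>) 0 > z \<and> X j \<omega> > z) / (i.F z + j.F z) < \<delta>"
    using pQAI ij \<delta> unfolding pQAI_def i.F_def j.F_def by (auto intro!: order_tendstoD(2))
  show ?thesis
    using eventually_compose_filterlim[OF plus lim] eventually_compose_filterlim[OF minus lim]
      eventually_ge_at_top[of 0] Ci(2) Cj(2)
  proof eventually_elim
    case (elim x)
    define z where "z = a * x"
    note [measurable] = i.X_rv j.X_rv
    have FF: "i.F z + j.F z > 0" using i.F_pos j.F_pos by (simp add: add_pos_pos)
    have z1: "d * x / n / B = z" by (simp add: z_def a_def)
    have z2: "z \<le> x / n / B"
    proof -
      have "d * x \<le> 1 * x" using d elim by (intro mult_right_mono) auto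
      then have "d * x / n / B \<le> x / n / B" using n j.B_pos by (intro divide_right_mono) auto
      then show ?thesis by (simp only: z1)
    qed
    have "\<P>(\<omega> in M. \<bar>\<Theta> i \<omega> * X i \<omega>\<bar> > d * x / n \<and> \<Theta> j \<omega> * X j \<omega> > x / n)
        \<le> \<P>(\<omega> in M. \<bar>X i \<omega>\<bar> > d * x / n / B \<and> X j \<omega> > x / n / B)"
      using elim n d
      by (intro joint_tail_bounded_weights i.X_rv j.X_rv i.T_rv j.T_rv i.T_bounds j.T_bounds j.B_pos) auto
    also have "\<dots> \<le> prob ({\<omega>\<in>space M. max (X i \<omega>) 0 > z \<and> max (X j \<omega>) 0 > z} \<union>
        {\<omega>\<in>space M. - min (X i \<omega>) 0 > z \<and> X j \<omega> > z})"
      unfolding z1 using z2 by (intro finite_measure_mono) (auto simp: abs_real_def max_def min_def split: if_splits)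
    also have "\<dots> \<le> \<P>(\<omega> in M. max (X i \<omega>) 0 > z \<and> max (X j \<omega>) 0 > z) +
        \<P>(\<omega> in M. - min (X i \<omega>) 0 > z \<and> X j \<omega> > z)"
      by (intro measure_Un_le) measurable
    also have "\<dots> \<le> \<delta> * (i.F z + j.F z) + \<delta> * (i.F z + j.F z)"
      using elim(1,2) FF unfolding z_def[symmetric] by (intro add_mono less_imp_le) (simp_all add: pos_divide_less_eq)
    also have "\<dots> = 2 * \<delta> * (i.F z + j.F z)" by simp
    also have "\<dots> \<le> 2 * \<delta> * ((Ci + Cj) * (i.H x + j.H x))"
    proof (intro mult_left_mono)
      have "i.F z \<le> Ci * i.H x" "j.F z \<le> Cj * j.H x" using elim by (simp_all add: z_def)
      moreover have "0 \<le> Cj * i.H x" "0 \<le> Ci * j.H x" using Ci Cj by (simp_all add: i.H_def j.H_def)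
      ultimately show "i.F z + j.F z \<le> (Ci + Cj) * (i.H x + j.H x)" by (simp add: algebra_simps)
    qed (use \<delta> in simp)
    also have "\<dots> = (2 * \<delta> * (Ci + Cj)) * (i.H x + j.H x)" by simp
    also have "2 * \<delta> * (Ci + Cj) = \<epsilon>"
      using add_pos_pos[OF Ci(1) Cj(1)] by (simp add: \<delta>_def field_simps)
    finally show ?case by (simp add: i.H_def j.H_def)
  qed
qed

text \<open>
  Tails in the locale are probabilities; the hypotheses here speak of the distribution of \<open>X\<close>.
\<close>

lemma bounded_weightI:
  fixes X T :: "'a \<Rightarrow> real" and h :: "real \<Rightarrow> real"
  assumes X: "random_variable borel X" and T: "random_variable borel T"
    and bounds: "AE \<omega> in M. 0 \<le> T \<omega> \<and> T \<omega> \<le> B" and B: "B > 0"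
    and nd: "\<not> (AE \<omega> in M. T \<omega> = 0)"
    and pos: "\<And>x. x \<ge> 0 \<Longrightarrow> tail (distr M borel X) x > 0"
    and dom: "dominatedly_varying (distr M borel X)"
    and h_pos: "\<And>\<theta>. \<theta> \<ge> 0 \<Longrightarrow> h \<theta> > 0"
    and ex: "\<forall>\<^sub>F x in at_top. \<forall>\<theta>\<in>supp M T. cprob_exists M (\<lambda>\<omega>. X \<omega> > x) T \<theta>"
    and equiv: "unif_asymp_equiv (supp M T) at_top
        (\<lambda>x \<theta>. cprob M (\<lambda>\<omega>. X \<omega> > x) T \<theta>) (\<lambda>x \<theta>. h \<theta> * \<P>(\<omega> in M. X \<omega> > x))"
  shows "bounded_weight M X T B"
proof -
  note [measurable] = X T
  have nn: "AE \<omega> in M. T \<omega> \<ge> 0" using bounds by eventually_elim simp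
  have tp: "\<P>(\<omega> in M. X \<omega> > x) > 0" for x
  proof -
    have "0 < \<P>(\<omega> in M. X \<omega> > max x 0)" using pos[of "max x 0"] tail_distr[OF X] by simp
    also have "\<dots> \<le> \<P>(\<omega> in M. X \<omega> > x)" by (intro finite_measure_mono) auto
    finally show ?thesis .
  qed
  have dom': "\<exists>C>0. \<forall>\<^sub>F x in at_top. \<P>(\<omega> in M. X \<omega> > b * x) \<le> C * \<P>(\<omega> in M. X \<omega> > x)"
    if b: "0 < b" "b < 1" for b
  proof -
    have "Limsup at_top (\<lambda>x. ereal (tail (distr M borel X) (b * x) / tail (distr M borel X) x)) < \<infinity>"
      using dom b unfolding dominatedly_varying_def by blast
    then obtain C where
      "Limsup at_top (\<lambda>x. ereal (tail (distr M borel X) (b * x) / tail (distr M borel X) x)) < ereal C"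
      using ereal_dense2 by blast
    then have ev: "\<forall>\<^sub>F x in at_top.
        ereal (tail (distr M borel X) (b * x) / tail (distr M borel X) x) < ereal C"
      by (rule Limsup_lessD)
    show ?thesis
    proof (intro exI[of _ "\<bar>C\<bar> + 1"] conjI)
      show "\<forall>\<^sub>F x in at_top. \<P>(\<omega> in M. X \<omega> > b * x) \<le> (\<bar>C\<bar> + 1) * \<P>(\<omega> in M. X \<omega> > x)"
        using ev
      proof eventually_elim
        case (elim x)
        then have "\<P>(\<omega> in M. X \<omega> > b * x) < C * \<P>(\<omega> in M. X \<omega> > x)"
          using tp[of x] by (simp add: tail_distr[OF X] pos_divide_less_eq)
        also have "\<dots> \<le> (\<bar>C\<bar> + 1) * \<P>(\<omega> in M. X \<omega> > x)" by (intro mult_right_mono) auto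
        finally show ?case by simp
      qed
    qed simp
  qed
  note comparison = cprob_tail_comparison[OF X T nn tp h_pos ex equiv]
  note weight_pos = cprob_pos_window[OF X T nn nd tp h_pos ex equiv]
  show ?thesis
  proof
    show "random_variable borel X" "random_variable borel T" "B > 0"
      "AE \<omega> in M. 0 \<le> T \<omega> \<and> T \<omega> \<le> B" by (fact X T B bounds)+
  qed (rule tp dom' comparison weight_pos; assumption)+
qed

end

lemma (in bounded_weight) eventually_weighted_tail_shift:
  assumes long: "long_tailed (distr M borel X)" and a: "a > 0" and \<eta>: "\<eta> > 0"
  shows "\<forall>\<^sub>F x in at_top. H (x - a) \<le> (1 + \<eta>) * H x \<and> H x \<le> (1 + \<eta>) * H (x + a)"
proof -
  have "((\<lambda>x. F (x - a) / F x) \<longlongrightarrow> 1) at_top" if "a > 0" for a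
    using long that unfolding long_tailed_def by (simp add: tail_distr[OF X_rv] F_def)
  then have 1: "\<forall>\<^sub>F x in at_top. H (x - a) \<le> (1 + \<eta>) * H x"
    using a \<eta> by (rule weighted_long_tailed)
  have "filterlim (\<lambda>x. x + a) at_top at_top"
    unfolding filterlim_at_top
  proof
    fix Z
    show "\<forall>\<^sub>F x in at_top. Z \<le> x + a"
      using eventually_ge_at_top[of "Z - a"] by eventually_elim simp
  qed
  then have "\<forall>\<^sub>F x in at_top. H (x + a - a) \<le> (1 + \<eta>) * H (x + a)"
    by (rule eventually_compose_filterlim[OF 1])
  with 1 show ?thesis by eventually_elim simp
qed

lemma (in bounded_weight) eventually_weighted_tail_scale:
  assumes cons: "consistently_varying (distr M borel X)" and \<eta>: "\<eta> > 0"
  shows "\<forall>\<^sub>F v in at_left 1. \<forall>\<^sub>F x in at_top. H (v * x) \<le> (1 + \<eta>) * H x"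
proof -
  have "\<exists>v. 0 < v \<and> v < 1 \<and> (\<forall>\<^sub>F x in at_top. F (v * x) \<le> (1 + e) * F x)" if e: "e > 0" for e
  proof -
    define G where "G v = Limsup at_top (\<lambda>x. ereal (tail (distr M borel X) (v * x) / tail (distr M borel X) x))" for v
    have "\<forall>\<^sub>F v in at_left 1. G v < ereal (1 + e)"
      using cons e unfolding consistently_varying_def G_def by (intro order_tendstoD(2)) auto
    moreover have "\<forall>\<^sub>F v in at_left 1. v \<in> {0<..<(1::real)}"
      by (rule eventually_at_left_field[THEN iffD2]) (auto intro!: exI[of _ 0])
    ultimately have "\<forall>\<^sub>F v in at_left 1. G v < ereal (1 + e) \<and> v \<in> {0<..<1}" by (rule eventually_conj)
    then obtain v where v: "G v < ereal (1 + e)" "0 < v" "v < 1"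
      using eventually_happens'[OF trivial_limit_at_left_real] by auto
    have "\<forall>\<^sub>F x in at_top. ereal (tail (distr M borel X) (v * x) / tail (distr M borel X) x) < ereal (1 + e)"
      using v(1) unfolding G_def by (rule Limsup_lessD)
    then have "\<forall>\<^sub>F x in at_top. F (v * x) \<le> (1 + e) * F x"
    proof eventually_elim
      case (elim x)
      then show ?case using F_pos[of x] by (simp add: tail_distr[OF X_rv] F_def pos_divide_less_eq)
    qed
    then show ?thesis using v by blast
  qed
  then obtain v where v: "0 < v" "v < 1" "\<forall>\<^sub>F x in at_top. H (v * x) \<le> (1 + \<eta>) * H x"
    using weighted_consistently_varying[OF _ \<eta>] by blast
  have "H y \<le> H x" if "x \<le> y" for x y
    unfolding H_def using that by (intro finite_measure_mono) auto
  then show ?thesis using v by (rule eventually_at_left_1_tail)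
qed

section \<open>Sums and maxima of weighted variables\<close>

lemma (in prob_space) weighted_sums_equivalent:
  fixes X \<Theta> :: "nat \<Rightarrow> 'a \<Rightarrow> real" and n :: nat
  defines "H \<equiv> \<lambda>i x. \<P>(\<omega> in M. \<Theta> i \<omega> * X i \<omega> > x)"
  defines "S \<equiv> \<lambda>x. \<Sum>i=1..n. H i x"
  assumes n: "n \<ge> 1"
    and X: "\<And>i. i \<in> {1..n} \<Longrightarrow> random_variable borel (X i)"
    and \<Theta>: "\<And>i. i \<in> {1..n} \<Longrightarrow> random_variable borel (\<Theta> i)"
    and pos: "\<forall>\<^sub>F x in at_top. S x > 0"
    and key: "\<And>\<epsilon>. \<epsilon> > 0 \<Longrightarrow> \<exists>l. \<forall>\<^sub>F x in at_top. l x > 0 \<and>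
      (\<forall>i\<in>{1..n}. H i (x - l x) \<le> (1 + \<epsilon>) * H i x \<and> H i x \<le> (1 + \<epsilon>) * H i (x + l x)) \<and>
      (\<forall>i\<in>{1..n}. \<forall>j\<in>{1..n}. i \<noteq> j \<longrightarrow>
        \<P>(\<omega> in M. \<bar>\<Theta> i \<omega> * X i \<omega>\<bar> > l x / n \<and> \<Theta> j \<omega> * X j \<omega> > x / n) \<le> \<epsilon> * S x)"
  shows "(\<lambda>x. \<P>(\<omega> in M. wsum \<Theta> X n \<omega> > x)) \<sim>[at_top] S"
    and "(\<lambda>x. \<P>(\<omega> in M. (MAX k\<in>{1..n}. wsum \<Theta> X k \<omega>) > x)) \<sim>[at_top] S"
    and "(\<lambda>x. \<P>(\<omega> in M. (MAX i\<in>{1..n}. \<Theta> i \<omega> * X i \<omega>) > x)) \<sim>[at_top] S"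
proof -
  define Y where "Y i \<omega> = \<Theta> i \<omega> * X i \<omega>" for i \<omega>
  have Y: "random_variable borel (Y i)" if "i \<in> {1..n}" for i
    unfolding Y_def using X[OF that] \<Theta>[OF that] by measurable
  have HY: "H = (\<lambda>i x. \<P>(\<omega> in M. Y i \<omega> > x))" by (simp add: H_def Y_def)
  have SY: "S = (\<lambda>x. \<Sum>i=1..n. \<P>(\<omega> in M. Y i \<omega> > x))" by (simp add: S_def HY)
  note keyY = key[folded Y_def, unfolded HY SY]
  note posY = pos[unfolded SY]
  have wsum: "wsum \<Theta> X k \<omega> = (\<Sum>i=1..k. Y i \<omega>)" for k \<omega> by (simp add: wsum_def Y_def)
  have wsum_meas: "random_variable borel (\<lambda>\<omega>. wsum \<Theta> X k \<omega>)" if "k \<in> {1..n}" for k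
    unfolding wsum using that Y by (intro borel_measurable_sum) auto
  have wsum_le: "wsum \<Theta> X k \<omega> \<le> (\<Sum>i=1..n. max (Y i \<omega>) 0)" if "k \<in> {1..n}" for k \<omega>
  proof -
    have "wsum \<Theta> X k \<omega> \<le> (\<Sum>i=1..k. max (Y i \<omega>) 0)" unfolding wsum by (intro sum_mono) auto
    also have "\<dots> \<le> (\<Sum>i=1..n. max (Y i \<omega>) 0)" using that by (intro sum_mono2) auto
    finally show ?thesis .
  qed
  have wsum_gt: "wsum \<Theta> X n \<omega> > x"
    if l: "l > 0" and j: "j \<in> {1..n}" "Y j \<omega> > x + l"
      and small: "\<And>i. i \<in> {1..n} - {j} \<Longrightarrow> \<bar>Y i \<omega>\<bar> \<le> l / n"
    for \<omega> and j :: nat and x l :: real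
  proof -
    have "(\<Sum>i\<in>{1..n} - {j}. - (l / n)) \<le> (\<Sum>i\<in>{1..n} - {j}. Y i \<omega>)"
      using small by (intro sum_mono) (auto simp: abs_le_iff minus_le_iff)
    moreover have "(\<Sum>i\<in>{1..n} - {j}. l / n) \<le> (\<Sum>i\<in>{1..n}. l / n)"
      using l by (intro sum_mono2) auto
    moreover have "(\<Sum>i\<in>{1..n}. l / n) = l" using n by simp
    moreover have "wsum \<Theta> X n \<omega> = Y j \<omega> + (\<Sum>i\<in>{1..n} - {j}. Y i \<omega>)"
      unfolding wsum using j by (intro sum.remove) auto
    ultimately show ?thesis using j(2) by (simp add: sum_negf)
  qed
  have max_rv: "random_variable borel (\<lambda>\<omega>. MAX k\<in>{1..n}. wsum \<Theta> X k \<omega>)"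
    using wsum_meas by (intro borel_measurable_Max) auto
  have max_le: "(MAX k\<in>{1..n}. wsum \<Theta> X k \<omega>) \<le> (\<Sum>i=1..n. max (Y i \<omega>) 0)" for \<omega>
    using n wsum_le by (subst Max_le_iff) auto
  have max_gt: "(MAX k\<in>{1..n}. wsum \<Theta> X k \<omega>) > x"
    if "l > 0" "j \<in> {1..n}" "Y j \<omega> > x + l" "\<And>i. i \<in> {1..n} - {j} \<Longrightarrow> \<bar>Y i \<omega>\<bar> \<le> l / n"
    for \<omega> and j :: nat and x l :: real
  proof -
    have "x < wsum \<Theta> X n \<omega>" using that by (rule wsum_gt)
    also have "\<dots> \<le> (MAX k\<in>{1..n}. wsum \<Theta> X k \<omega>)" using n by (intro Max_ge) auto
    finally show ?thesis .
  qed
  have maxY_rv: "random_variable borel (\<lambda>\<omega>. MAX i\<in>{1..n}. Y i \<omega>)"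
    using Y by (intro borel_measurable_Max) auto
  have maxY_le: "(MAX i\<in>{1..n}. Y i \<omega>) \<le> (\<Sum>i=1..n. max (Y i \<omega>) 0)" for \<omega>
  proof -
    have "Y i \<omega> \<le> (\<Sum>i=1..n. max (Y i \<omega>) 0)" if "i \<in> {1..n}" for i
    proof -
      have "Y i \<omega> \<le> max (Y i \<omega>) 0" by simp
      also have "\<dots> \<le> (\<Sum>i=1..n. max (Y i \<omega>) 0)" using that by (intro member_le_sum) auto
      finally show ?thesis .
    qed
    then show ?thesis using n by (subst Max_le_iff) auto
  qed
  have maxY_gt: "(MAX i\<in>{1..n}. Y i \<omega>) > x" if "l > 0" "j \<in> {1..n}" "Y j \<omega> > x + l"
    for \<omega> and j :: nat and x l :: real
  proof -
    have "x < Y j \<omega>" using that by simp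
    also have "\<dots> \<le> (MAX i\<in>{1..n}. Y i \<omega>)" using that by (intro Max_ge) auto
    finally show ?thesis .
  qed
  show "(\<lambda>x. \<P>(\<omega> in M. wsum \<Theta> X n \<omega> > x)) \<sim>[at_top] S"
    unfolding SY using n
    by (intro one_big_jump n Y wsum_meas posY keyY wsum_le wsum_gt) auto
  show "(\<lambda>x. \<P>(\<omega> in M. (MAX k\<in>{1..n}. wsum \<Theta> X k \<omega>) > x)) \<sim>[at_top] S"
    unfolding SY by (intro one_big_jump n Y max_rv posY keyY max_le max_gt) auto
  show "(\<lambda>x. \<P>(\<omega> in M. (MAX i\<in>{1..n}. \<Theta> i \<omega> * X i \<omega>) > x)) \<sim>[at_top] S"
    unfolding SY Y_def[symmetric] by (intro one_big_jump n Y maxY_rv posY keyY maxY_le maxY_gt) auto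
qed

theorem theorem3p2:
  fixes M :: "'a measure" and n :: nat
    and X \<Theta> :: "nat \<Rightarrow> 'a \<Rightarrow> real"
    and b h :: "nat \<Rightarrow> real \<Rightarrow> real"
    and g :: "nat \<Rightarrow> nat \<Rightarrow> real \<times> real \<Rightarrow> real"
    and L U :: real
  assumes "prob_space M" and "n \<ge> 1"
    and X_rv: "\<And>i. i \<in> {1..n} \<Longrightarrow> X i \<in> borel_measurable M"
    and X_tail: "\<And>i x. i \<in> {1..n} \<Longrightarrow> x \<ge> 0 \<Longrightarrow> tail (distr M borel (X i)) x > 0"
    and X_D: "\<And>i. i \<in> {1..n} \<Longrightarrow> dominatedly_varying (distr M borel (X i))"
    and X_L: "\<And>i. i \<in> {1..n} \<Longrightarrow> long_tailed (distr M borel (X i))"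
    and \<Theta>_rv: "\<And>i. i \<in> {1..n} \<Longrightarrow> \<Theta> i \<in> borel_measurable M"
    and \<Theta>_nonneg: "\<And>i. i \<in> {1..n} \<Longrightarrow> AE \<omega> in M. \<Theta> i \<omega> \<ge> 0"
    and \<Theta>_nondeg: "\<And>i. i \<in> {1..n} \<Longrightarrow> \<not> (AE \<omega> in M. \<Theta> i \<omega> = 0)"
    \<comment> \<open>condition (i)\<close>
    and b_pos: "\<And>i x. i \<in> {1..n} \<Longrightarrow> x \<ge> 0 \<Longrightarrow> b i x > 0"
    and b_top: "\<And>i. i \<in> {1..n} \<Longrightarrow> filterlim (b i) at_top at_top"
    and b_sublinear: "\<And>i. i \<in> {1..n} \<Longrightarrow> ((\<lambda>x. b i x / x) \<longlongrightarrow> 0) at_top"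
    and b_small: "\<And>i j. i \<in> {1..n} \<Longrightarrow> j \<in> {1..n} \<Longrightarrow> i \<noteq> j \<Longrightarrow>
      (\<lambda>(xi, xj). \<P>(\<omega> in M. \<Theta> i \<omega> > b i xi))
        \<in> o[at_top \<times>\<^sub>F at_top](\<lambda>(xi, xj). \<P>(\<omega> in M. \<Theta> i \<omega> * X i \<omega> > xi \<and> \<Theta> j \<omega> * X j \<omega> > xj))"
    \<comment> \<open>condition (ii)\<close>
    and h_pos: "\<And>i \<theta>. i \<in> {1..n} \<Longrightarrow> \<theta> \<ge> 0 \<Longrightarrow> h i \<theta> > 0"
    and h_exists: "\<And>i. i \<in> {1..n} \<Longrightarrow>
      \<forall>\<^sub>F x in at_top. \<forall>\<theta>\<in>supp M (\<Theta> i). cprob_exists M (\<lambda>\<omega>. X i \<omega> > x) (\<Theta> i) \<theta>"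
    and h_equiv: "\<And>i. i \<in> {1..n} \<Longrightarrow>
      unif_asymp_equiv (supp M (\<Theta> i)) at_top
        (\<lambda>x \<theta>. cprob M (\<lambda>\<omega>. X i \<omega> > x) (\<Theta> i) \<theta>)
        (\<lambda>x \<theta>. h i \<theta> * \<P>(\<omega> in M. X i \<omega> > x))"
    \<comment> \<open>condition (iii)\<close>
    and g_meas: "\<And>i j. i \<in> {1..n} \<Longrightarrow> j \<in> {1..n} \<Longrightarrow> i \<noteq> j \<Longrightarrow>
      g i j \<in> borel_measurable (restrict_space borel ({0..} \<times> {0..}))"
    and g_pos: "\<And>i j \<theta> \<theta>'. i \<in> {1..n} \<Longrightarrow> j \<in> {1..n} \<Longrightarrow> i \<noteq> j \<Longrightarrow>
      \<theta> \<ge> 0 \<Longrightarrow> \<theta>' \<ge> 0 \<Longrightarrow> g i j (\<theta>, \<theta>') > 0"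
    and LU: "0 < L" "L \<le> U"
    and g_exists_abs: "\<And>i j. i \<in> {1..n} \<Longrightarrow> j \<in> {1..n} \<Longrightarrow> i \<noteq> j \<Longrightarrow>
      \<forall>\<^sub>F (xi, xj) in at_top \<times>\<^sub>F at_top. \<forall>\<theta>\<in>supp M (\<Theta> i) \<times> supp M (\<Theta> j).
        cprob2_exists M (\<lambda>\<omega>. \<bar>X i \<omega>\<bar> > xi \<and> X j \<omega> > xj) (\<Theta> i) (\<Theta> j) \<theta>"
    and g_equiv: "\<And>i j. i \<in> {1..n} \<Longrightarrow> j \<in> {1..n} \<Longrightarrow> i \<noteq> j \<Longrightarrow>
      unif_asymp_equiv (supp M (\<Theta> i) \<times> supp M (\<Theta> j)) (at_top \<times>\<^sub>F at_top)
        (\<lambda>(xi, xj) \<theta>. cprob2 M (\<lambda>\<omega>. \<bar>X i \<omega>\<bar> > xi \<and> X j \<omega> > xj) (\<Theta> i) (\<Theta> j) \<theta>)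
        (\<lambda>(xi, xj) \<theta>. g i j \<theta> * \<P>(\<omega> in M. \<bar>X i \<omega>\<bar> > xi \<and> X j \<omega> > xj))"
    and g_exists: "\<And>i j. i \<in> {1..n} \<Longrightarrow> j \<in> {1..n} \<Longrightarrow> i \<noteq> j \<Longrightarrow>
      \<forall>\<^sub>F (xi, xj) in at_top \<times>\<^sub>F at_top. \<forall>\<theta>\<in>supp M (\<Theta> i) \<times> supp M (\<Theta> j).
        cprob2_exists M (\<lambda>\<omega>. X i \<omega> > xi \<and> X j \<omega> > xj) (\<Theta> i) (\<Theta> j) \<theta>"
    and g_lower: "\<And>i j. i \<in> {1..n} \<Longrightarrow> j \<in> {1..n} \<Longrightarrow> i \<noteq> j \<Longrightarrow>
      unif_asymp_le (supp M (\<Theta> i) \<times> supp M (\<Theta> j)) (at_top \<times>\<^sub>F at_top)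
        (\<lambda>(xi, xj) \<theta>. L * g i j \<theta> * \<P>(\<omega> in M. X i \<omega> > xi \<and> X j \<omega> > xj))
        (\<lambda>(xi, xj) \<theta>. cprob2 M (\<lambda>\<omega>. X i \<omega> > xi \<and> X j \<omega> > xj) (\<Theta> i) (\<Theta> j) \<theta>)"
    and g_upper: "\<And>i j. i \<in> {1..n} \<Longrightarrow> j \<in> {1..n} \<Longrightarrow> i \<noteq> j \<Longrightarrow>
      unif_asymp_le (supp M (\<Theta> i) \<times> supp M (\<Theta> j)) (at_top \<times>\<^sub>F at_top)
        (\<lambda>(xi, xj) \<theta>. cprob2 M (\<lambda>\<omega>. X i \<omega> > xi \<and> X j \<omega> > xj) (\<Theta> i) (\<Theta> j) \<theta>)
        (\<lambda>(xi, xj) \<theta>. U * g i j \<theta> * \<P>(\<omega> in M. X i \<omega> > xi \<and> X j \<omega> > xj))"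
  shows
    "(pTAI M n X \<longrightarrow>
        (\<lambda>x. \<P>(\<omega> in M. wsum \<Theta> X n \<omega> > x)) \<sim>[at_top]
        (\<lambda>x. \<P>(\<omega> in M. (MAX k\<in>{1..n}. wsum \<Theta> X k \<omega>) > x)) \<and>
        (\<lambda>x. \<P>(\<omega> in M. (MAX k\<in>{1..n}. wsum \<Theta> X k \<omega>) > x)) \<sim>[at_top]
        (\<lambda>x. \<P>(\<omega> in M. (MAX i\<in>{1..n}. \<Theta> i \<omega> * X i \<omega>) > x)) \<and>
        (\<lambda>x. \<P>(\<omega> in M. (MAX i\<in>{1..n}. \<Theta> i \<omega> * X i \<omega>) > x)) \<sim>[at_top]
        (\<lambda>x. \<Sum>i=1..n. \<P>(\<omega> in M. \<Theta> i \<omega> * X i \<omega> > x))) \<and>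
     (pQAI M n X \<and> (\<forall>i\<in>{1..n}. consistently_varying (distr M borel (X i))) \<longrightarrow>
        (\<lambda>x. \<P>(\<omega> in M. wsum \<Theta> X n \<omega> > x)) \<sim>[at_top]
        (\<lambda>x. \<P>(\<omega> in M. (MAX k\<in>{1..n}. wsum \<Theta> X k \<omega>) > x)) \<and>
        (\<lambda>x. \<P>(\<omega> in M. (MAX k\<in>{1..n}. wsum \<Theta> X k \<omega>) > x)) \<sim>[at_top]
        (\<lambda>x. \<Sum>i=1..n. \<P>(\<omega> in M. \<Theta> i \<omega> * X i \<omega> > x)))"
proof (cases "n = 1")
  case True
  show ?thesis by (simp add: True wsum_def)
next
  case False
  then have n2: "n \<ge> 2" using \<open>n \<ge> 1\<close> by simp
  interpret prob_space M by fact
  have "\<exists>B. AE \<omega> in M. \<Theta> i \<omega> \<le> B" if i: "i \<in> {1..n}" for i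
  proof -
    \<comment> \<open>Any second index will do.\<close>
    define j :: nat where "j = (if i = 1 then 2 else 1)"
    have j: "j \<in> {1..n}" "i \<noteq> j" using i n2 by (auto simp: j_def)
    show ?thesis
    proof (rule AE_bounded_if_small[OF \<Theta>_rv[OF i] _ _ b_small[OF i j]])
      show "random_variable borel (\<lambda>\<omega>. \<Theta> i \<omega> * X i \<omega>)" using \<Theta>_rv[OF i] X_rv[OF i] by measurable
      show "random_variable borel (\<lambda>\<omega>. \<Theta> j \<omega> * X j \<omega>)" using \<Theta>_rv[OF j(1)] X_rv[OF j(1)] by measurable
    qed
  qed
  then obtain B0 where B0: "\<And>i. i \<in> {1..n} \<Longrightarrow> AE \<omega> in M. \<Theta> i \<omega> \<le> B0 i" by metis
  define B where "B = 1 + (\<Sum>i=1..n. \<bar>B0 i\<bar>)"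
  have B: "B > 0" by (simp add: B_def add_pos_nonneg sum_nonneg)
  have bounds: "AE \<omega> in M. 0 \<le> \<Theta> i \<omega> \<and> \<Theta> i \<omega> \<le> B" if i: "i \<in> {1..n}" for i
  proof -
    have "\<bar>B0 i\<bar> \<le> (\<Sum>i=1..n. \<bar>B0 i\<bar>)" using i by (intro member_le_sum) auto
    then have le: "B0 i \<le> B" by (simp add: B_def)
    show ?thesis using B0[OF i] \<Theta>_nonneg[OF i] by eventually_elim (use le in simp)
  qed
  have bw: "bounded_weight M (X i) (\<Theta> i) B" if i: "i \<in> {1..n}" for i
    by (rule bounded_weightI[OF X_rv[OF i] \<Theta>_rv[OF i] bounds[OF i] B \<Theta>_nondeg[OF i] X_tail[OF i]
      X_D[OF i] h_pos[OF i] h_exists[OF i] h_equiv[OF i]])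
  define H where "H i x = \<P>(\<omega> in M. \<Theta> i \<omega> * X i \<omega> > x)" for i x
  define S where "S = (\<lambda>x. \<Sum>i=1..n. H i x)"
  have H_bw: "bounded_weight.H M (X i) (\<Theta> i) = H i" if "i \<in> {1..n}" for i
    using bounded_weight.H_def[OF bw[OF that]] by (simp add: H_def fun_eq_iff)
  have H_nonneg: "H i x \<ge> 0" for i x by (simp add: H_def)
  have H_le: "H i x \<le> S x" if "i \<in> {1..n}" for i x
    unfolding S_def using that H_nonneg by (intro member_le_sum) auto
  have pos: "\<forall>\<^sub>F x in at_top. S x > 0"
  proof -
    have 1: "1 \<in> {1..n}" using n2 by simp
    have "\<forall>\<^sub>F x in at_top. H 1 x > 0"
      using bounded_weight.weighted_tail_pos[OF bw[OF 1]] unfolding H_bw[OF 1] .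
    then show ?thesis
    proof eventually_elim
      case (elim x)
      then show ?case using H_le[OF 1] by (rule less_le_trans)
    qed
  qed
  \<comment> \<open>Existence of a slack with relative error \<open>\<epsilon>\<close>: a large constant in the tail independent case,
    a small multiple of \<open>x\<close> in the quasi-asymptotically independent case.\<close>
  define K where "K \<epsilon> \<longleftrightarrow> (\<exists>l. \<forall>\<^sub>F x in at_top. l x > 0 \<and>
          (\<forall>i\<in>{1..n}. H i (x - l x) \<le> (1 + \<epsilon>) * H i x \<and> H i x \<le> (1 + \<epsilon>) * H i (x + l x)) \<and>
          (\<forall>i\<in>{1..n}. \<forall>j\<in>{1..n}. i \<noteq> j \<longrightarrow>
            \<P>(\<omega> in M. \<bar>\<Theta> i \<omega> * X i \<omega>\<bar> > l x / n \<and> \<Theta> j \<omega> * X j \<omega> > x / n) \<le> \<epsilon> * S x))" for \<epsilon> :: real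
  have equivalences:
    "(\<lambda>x. \<P>(\<omega> in M. wsum \<Theta> X n \<omega> > x)) \<sim>[at_top] S"
    "(\<lambda>x. \<P>(\<omega> in M. (MAX k\<in>{1..n}. wsum \<Theta> X k \<omega>) > x)) \<sim>[at_top] S"
    "(\<lambda>x. \<P>(\<omega> in M. (MAX i\<in>{1..n}. \<Theta> i \<omega> * X i \<omega>) > x)) \<sim>[at_top] S"
    if "\<And>\<epsilon>. \<epsilon> > 0 \<Longrightarrow> K \<epsilon>"
  proof -
    note pos' = pos[unfolded S_def H_def] and that' = that[unfolded K_def S_def H_def]
    show "(\<lambda>x. \<P>(\<omega> in M. wsum \<Theta> X n \<omega> > x)) \<sim>[at_top] S"
      unfolding S_def H_def by (rule weighted_sums_equivalent(1)[OF \<open>n \<ge> 1\<close> X_rv \<Theta>_rv pos' that'])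
    show "(\<lambda>x. \<P>(\<omega> in M. (MAX k\<in>{1..n}. wsum \<Theta> X k \<omega>) > x)) \<sim>[at_top] S"
      unfolding S_def H_def by (rule weighted_sums_equivalent(2)[OF \<open>n \<ge> 1\<close> X_rv \<Theta>_rv pos' that'])
    show "(\<lambda>x. \<P>(\<omega> in M. (MAX i\<in>{1..n}. \<Theta> i \<omega> * X i \<omega>) > x)) \<sim>[at_top] S"
      unfolding S_def H_def by (rule weighted_sums_equivalent(3)[OF \<open>n \<ge> 1\<close> X_rv \<Theta>_rv pos' that'])
  qed
  have TAI: "K \<epsilon>"
    if pTAI: "pTAI M n X" and \<epsilon>: "\<epsilon> > 0" for \<epsilon>
  proof -
    have "\<forall>i\<in>{1..n}. \<forall>j\<in>{1..n}. \<forall>\<^sub>F l in at_top. i \<noteq> j \<longrightarrow> (\<forall>\<^sub>F x in at_top.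
        \<P>(\<omega> in M. \<bar>\<Theta> i \<omega> * X i \<omega>\<bar> > l / n \<and> \<Theta> j \<omega> * X j \<omega> > x / n) \<le> \<epsilon> * H j x)"
    proof (intro ballI)
      fix i j assume ij: "i \<in> {1..n}" "j \<in> {1..n}"
      show "\<forall>\<^sub>F l in at_top. i \<noteq> j \<longrightarrow> (\<forall>\<^sub>F x in at_top.
        \<P>(\<omega> in M. \<bar>\<Theta> i \<omega> * X i \<omega>\<bar> > l / n \<and> \<Theta> j \<omega> * X j \<omega> > x / n) \<le> \<epsilon> * H j x)"
      proof (cases "i = j")
        case False
        show ?thesis
          using pTAI_weighted_joint_tail[OF pTAI ij False bw[OF ij(1)] bw[OF ij(2)] \<epsilon>]
          unfolding H_def by eventually_elim blast
      qed simp
    qed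
    then have "\<forall>\<^sub>F l in at_top. \<forall>i\<in>{1..n}. \<forall>j\<in>{1..n}. i \<noteq> j \<longrightarrow> (\<forall>\<^sub>F x in at_top.
        \<P>(\<omega> in M. \<bar>\<Theta> i \<omega> * X i \<omega>\<bar> > l / n \<and> \<Theta> j \<omega> * X j \<omega> > x / n) \<le> \<epsilon> * H j x)"
      by (simp add: eventually_ball_finite_distrib)
    then have "\<forall>\<^sub>F l in at_top. l > 0 \<and> (\<forall>i\<in>{1..n}. \<forall>j\<in>{1..n}. i \<noteq> j \<longrightarrow> (\<forall>\<^sub>F x in at_top.
        \<P>(\<omega> in M. \<bar>\<Theta> i \<omega> * X i \<omega>\<bar> > l / n \<and> \<Theta> j \<omega> * X j \<omega> > x / n) \<le> \<epsilon> * H j x))"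
      by (intro eventually_conj eventually_gt_at_top)
    then obtain l where l: "l > 0" and joint: "\<forall>i\<in>{1..n}. \<forall>j\<in>{1..n}. i \<noteq> j \<longrightarrow> (\<forall>\<^sub>F x in at_top.
        \<P>(\<omega> in M. \<bar>\<Theta> i \<omega> * X i \<omega>\<bar> > l / n \<and> \<Theta> j \<omega> * X j \<omega> > x / n) \<le> \<epsilon> * H j x)"
      using eventually_happens'[OF trivial_limit_at_top_linorder] by blast
    have "\<forall>\<^sub>F x in at_top. \<forall>i\<in>{1..n}. \<forall>j\<in>{1..n}. i \<noteq> j \<longrightarrow>
        \<P>(\<omega> in M. \<bar>\<Theta> i \<omega> * X i \<omega>\<bar> > l / n \<and> \<Theta> j \<omega> * X j \<omega> > x / n) \<le> \<epsilon> * H j x"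
    proof (intro eventually_ball_finite ballI)
      fix i j assume ij: "i \<in> {1..n}" "j \<in> {1..n}"
      show "\<forall>\<^sub>F x in at_top. i \<noteq> j \<longrightarrow>
        \<P>(\<omega> in M. \<bar>\<Theta> i \<omega> * X i \<omega>\<bar> > l / n \<and> \<Theta> j \<omega> * X j \<omega> > x / n) \<le> \<epsilon> * H j x"
        using joint ij by (cases "i = j") auto
    qed auto
    moreover have "\<forall>\<^sub>F x in at_top. \<forall>i\<in>{1..n}.
        H i (x - l) \<le> (1 + \<epsilon>) * H i x \<and> H i x \<le> (1 + \<epsilon>) * H i (x + l)"
    proof (intro eventually_ball_finite ballI)
      fix i assume i: "i \<in> {1..n}"
      show "\<forall>\<^sub>F x in at_top. H i (x - l) \<le> (1 + \<epsilon>) * H i x \<and> H i x \<le> (1 + \<epsilon>) * H i (x + l)"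
        using bounded_weight.eventually_weighted_tail_shift[OF bw[OF i] X_L[OF i] l \<epsilon>]
        by (simp add: H_bw[OF i])
    qed simp
    ultimately have "\<forall>\<^sub>F x in at_top. l > 0 \<and>
      (\<forall>i\<in>{1..n}. H i (x - l) \<le> (1 + \<epsilon>) * H i x \<and> H i x \<le> (1 + \<epsilon>) * H i (x + l)) \<and>
      (\<forall>i\<in>{1..n}. \<forall>j\<in>{1..n}. i \<noteq> j \<longrightarrow>
        \<P>(\<omega> in M. \<bar>\<Theta> i \<omega> * X i \<omega>\<bar> > l / n \<and> \<Theta> j \<omega> * X j \<omega> > x / n) \<le> \<epsilon> * S x)"
    proof eventually_elim
      case (elim x)
      have "\<epsilon> * H j x \<le> \<epsilon> * S x" if "j \<in> {1..n}" for j
        using H_le[OF that] \<epsilon> by (intro mult_left_mono) auto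
      then show ?case using elim l by (meson order_trans)
    qed
    then show ?thesis unfolding K_def by (rule exI[of _ "\<lambda>_. l"])
  qed
  have QAI: "K \<epsilon>"
    if pQAI: "pQAI M n X" and C: "\<forall>i\<in>{1..n}. consistently_varying (distr M borel (X i))"
      and \<epsilon>: "\<epsilon> > 0" for \<epsilon>
  proof -
    have "\<forall>\<^sub>F v in at_left 1. \<forall>i\<in>{1..n}. \<forall>\<^sub>F x in at_top. H i (v * x) \<le> (1 + \<epsilon>) * H i x"
    proof (intro eventually_ball_finite ballI)
      fix i assume i: "i \<in> {1..n}"
      show "\<forall>\<^sub>F v in at_left 1. \<forall>\<^sub>F x in at_top. H i (v * x) \<le> (1 + \<epsilon>) * H i x"
        using bounded_weight.eventually_weighted_tail_scale[OF bw[OF i] bspec[OF C i] \<epsilon>]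
        by (simp add: H_bw[OF i])
    qed simp
    moreover have "\<forall>\<^sub>F v in at_left 1. v \<in> {0<..<(1::real)}"
      by (rule eventually_at_left_field[THEN iffD2]) (auto intro!: exI[of _ 0])
    ultimately have "\<forall>\<^sub>F v in at_left 1. v \<in> {0<..<1} \<and>
        (\<forall>i\<in>{1..n}. \<forall>\<^sub>F x in at_top. H i (v * x) \<le> (1 + \<epsilon>) * H i x)"
      by eventually_elim blast
    then obtain v where "v \<in> {0<..<1} \<and>
        (\<forall>i\<in>{1..n}. \<forall>\<^sub>F x in at_top. H i (v * x) \<le> (1 + \<epsilon>) * H i x)"
      using eventually_happens'[OF trivial_limit_at_left_real] by blast
    then have v: "0 < v" "v < 1"
      and scale: "\<And>i. i \<in> {1..n} \<Longrightarrow> \<forall>\<^sub>F x in at_top. H i (v * x) \<le> (1 + \<epsilon>) * H i x"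
      by simp_all
    \<comment> \<open>Then \<open>x - d * x = v * x\<close> and \<open>v * (x + d * x) \<le> x\<close> for \<open>x \<ge> 0\<close>:
      the factor \<open>v\<close> serves both directions.\<close>
    define d where "d = 1 - v"
    have d: "0 < d" "d \<le> 1" using v by (auto simp: d_def)
    have "v * (1 + d) = 1 - (1 - v)\<^sup>2" by (simp add: d_def power2_eq_square algebra_simps)
    then have vd: "v * (1 + d) \<le> 1" by simp
    have e2: "\<epsilon> / 2 > 0" using \<epsilon> by simp
    have "\<forall>\<^sub>F x in at_top. \<forall>i\<in>{1..n}. \<forall>j\<in>{1..n}. i \<noteq> j \<longrightarrow>
        \<P>(\<omega> in M. \<bar>\<Theta> i \<omega> * X i \<omega>\<bar> > d * x / n \<and> \<Theta> j \<omega> * X j \<omega> > x / n) \<le> \<epsilon> / 2 * (H i x + H j x)"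
    proof (intro eventually_ball_finite ballI)
      fix i j assume ij: "i \<in> {1..n}" "j \<in> {1..n}"
      show "\<forall>\<^sub>F x in at_top. i \<noteq> j \<longrightarrow>
        \<P>(\<omega> in M. \<bar>\<Theta> i \<omega> * X i \<omega>\<bar> > d * x / n \<and> \<Theta> j \<omega> * X j \<omega> > x / n) \<le> \<epsilon> / 2 * (H i x + H j x)"
      proof (cases "i = j")
        case False
        show ?thesis
          using pQAI_weighted_joint_tail[OF pQAI ij False bw[OF ij(1)] bw[OF ij(2)] e2 d]
          unfolding H_def by eventually_elim blast
      qed simp
    qed auto
    moreover have "\<forall>\<^sub>F x in at_top. \<forall>i\<in>{1..n}.
        H i (x - d * x) \<le> (1 + \<epsilon>) * H i x \<and> H i x \<le> (1 + \<epsilon>) * H i (x + d * x)"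
    proof (intro eventually_ball_finite ballI)
      fix i assume i: "i \<in> {1..n}"
      have "filterlim (\<lambda>x. (1 + d) * x) at_top at_top"
        using d by (intro filterlim_tendsto_pos_mult_at_top[OF tendsto_const _ filterlim_ident]) auto
      from scale[OF i] eventually_compose_filterlim[OF scale[OF i] this] eventually_ge_at_top[of 0]
      show "\<forall>\<^sub>F x in at_top. H i (x - d * x) \<le> (1 + \<epsilon>) * H i x \<and> H i x \<le> (1 + \<epsilon>) * H i (x + d * x)"
      proof eventually_elim
        case (elim x)
        have rv: "random_variable borel (\<lambda>\<omega>. \<Theta> i \<omega> * X i \<omega>)"
          using X_rv[OF i] \<Theta>_rv[OF i] by measurable
        have "v * ((1 + d) * x) \<le> 1 * x"
          using mult_right_mono[OF vd elim(3)] by (simp add: mult.assoc)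
        then have "H i x \<le> H i (v * ((1 + d) * x))"
          unfolding H_def using rv by (intro finite_measure_mono) auto
        moreover have "x - d * x = v * x" "x + d * x = (1 + d) * x" by (simp_all add: d_def algebra_simps)
        ultimately show ?case using elim(1,2) by simp
      qed
    qed simp
    ultimately have "\<forall>\<^sub>F x in at_top. d * x > 0 \<and>
      (\<forall>i\<in>{1..n}. H i (x - d * x) \<le> (1 + \<epsilon>) * H i x \<and> H i x \<le> (1 + \<epsilon>) * H i (x + d * x)) \<and>
      (\<forall>i\<in>{1..n}. \<forall>j\<in>{1..n}. i \<noteq> j \<longrightarrow>
        \<P>(\<omega> in M. \<bar>\<Theta> i \<omega> * X i \<omega>\<bar> > d * x / n \<and> \<Theta> j \<omega> * X j \<omega> > x / n) \<le> \<epsilon> * S x)"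
      using eventually_gt_at_top[of 0]
    proof eventually_elim
      case (elim x)
      have "\<epsilon> / 2 * (H i x + H j x) \<le> \<epsilon> * S x" if "i \<in> {1..n}" "j \<in> {1..n}" for i j
      proof -
        have "\<epsilon> / 2 * (H i x + H j x) \<le> \<epsilon> / 2 * (S x + S x)"
          using H_le[OF that(1)] H_le[OF that(2)] \<epsilon> by (intro mult_left_mono add_mono) auto
        then show ?thesis by simp
      qed
      then show ?case using elim d by (meson mult_pos_pos order_trans)
    qed
    then show ?thesis unfolding K_def by (rule exI[of _ "\<lambda>x. d * x"])
  qed
  show ?thesis
    unfolding H_def[symmetric] S_def[symmetric]
    using equivalences[OF TAI] equivalences[OF QAI]
    by (meson asymp_equiv_sym asymp_equiv_trans)
qed

end
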